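(* Let $(R,\mathfrak m)$ be a local OK domain of prime characteristic $p>0$ and dimension $d$, and let $I_\bullet$ be a $p$-family of $\mathfrak m$-primary ideals of $R$. Then $\operatorname{vol}_R(I_\bullet)>0$ if and only if there exists a power $q_\circ$ of $p$ such that $I_{qq_\circ}\subseteq\mathfrak m^{[q]}$ for all powers $q$ of $p$.
   Context: $p$ prime; $q$ denotes powers $p^e$, $e\ge0$. $I^{[q]}$ is the ideal generated by $\{x^q:x\in I\}$. A $p$-family of ideals is a sequence $\{I_q\}$ indexed by powers of $p$ with $I_q^{[p]}\subseteq I_{pq}$. $\operatorname{vol}_R(I_\bullet)=\lim_{q\to\infty}\ell_R(R/I_q)/q^d$ (this limit exists for $p$-families of $\mathfrak m$-primary ideals in OK domains). OK domain: fix $\mathbf a\in\mathbb R^d$ with $\mathbb Q$-linearly independent coordinates; order $\mathbb Z^d$ by $\mathbf u\le\mathbf v$ iff $\langle\mathbf u,\mathbf a\rangle\le\langle\mathbf v,\mathbf a\rangle$. A valuation $\nu:\mathbb F^\times\to\mathbb Z^d$ (surjective homomorphism, $\nu(x+y)\ge\min\{\nu(x),\nu(y)\}$ when $x,y,x+y\neq 0$) on the fraction field $\mathbb F$ of a $d$-dimensional local domain $(D,\mathfrak m,\Bbbk)$, with $\mathbb F_{\ge\mathbf u}=\{0\}\cup\{x:\nu(x)\ge\mathbf u\}$, valuation ring $V=\mathbb F_{\ge\mathbf 0}$ with maximal ideal $\mathfrak m_V$ and residue field $\Bbbk_V$, is OK relative to $D$ if (i) $D\subseteq V$, $\mathfrak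 m=\mathfrak m_V\cap D$; (ii) $\langle\mathbf u,\mathbf a\rangle>0$ for every nonzero $\mathbf u$ in the closed convex cone generated by $\nu(D\setminus0)$; (iii) $[\Bbbk_V:\Bbbk]<\infty$; (iv) there is $\mathbf v\in\mathbb Z^d$ with $D\cap\mathbb F_{\ge n\mathbf v}\subseteq\mathfrak m^n$ for all $n\ge0$. $D$ is OK if such $\nu$ exists. *)

theory Defs
  imports Complex_Main "HOL-Computational_Algebra.Fraction_Field" "HOL-Computational_Algebra.Primes"
begin

definition is_ideal :: "'a::comm_ring_1 set \<Rightarrow> bool" where
  "is_ideal I \<longleftrightarrow> 0 \<in> I \<and> (\<forall>x\<in>I. \<forall>y\<in>I. x + y \<in> I) \<and> (\<forall>r. \<forall>x\<in>I. r * x \<in> I)"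

definition ideal_gen :: "'a::comm_ring_1 set \<Rightarrow> 'a set" where
  "ideal_gen S = {x. \<exists>F c. finite F \<and> F \<subseteq> S \<and> x = (\<Sum>s\<in>F. c s * s)}"

definition ideal_prod :: "'a::comm_ring_1 set \<Rightarrow> 'a set \<Rightarrow> 'a set" where
  "ideal_prod I J = ideal_gen {x * y | x y. x \<in> I \<and> y \<in> J}"

fun ideal_pow :: "'a::comm_ring_1 set \<Rightarrow> nat \<Rightarrow> 'a set" where
  "ideal_pow I 0 = UNIV"
| "ideal_pow I (Suc n) = ideal_prod I (ideal_pow I n)"

definition frob_pow :: "nat \<Rightarrow> 'a::comm_ring_1 set \<Rightarrow> 'a set" where
  "frob_pow q I = ideal_gen {x ^ q | x. x \<in> I}"

definition prime_ideal :: "'a::comm_ring_1 set \<Rightarrow> bool" where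
  "prime_ideal P \<longleftrightarrow> is_ideal P \<and> P \<noteq> UNIV \<and> (\<forall>a b. a * b \<in> P \<longrightarrow> a \<in> P \<or> b \<in> P)"

definition maximal_ideal :: "'a::comm_ring_1 set \<Rightarrow> bool" where
  "maximal_ideal M \<longleftrightarrow> is_ideal M \<and> M \<noteq> UNIV \<and>
     (\<forall>J. is_ideal J \<and> M \<subseteq> J \<longrightarrow> J = M \<or> J = UNIV)"

definition noetherian_ring :: "'a::comm_ring_1 itself \<Rightarrow> bool" where
  "noetherian_ring _ \<longleftrightarrow> (\<forall>I::'a set. is_ideal I \<longrightarrow> (\<exists>F. finite F \<and> I = ideal_gen F))"

definition local_ring_with_max :: "'a::comm_ring_1 set \<Rightarrow> bool" where
  "local_ring_with_max m \<longleftrightarrow> noetherian_ring TYPE('a) \<and> maximal_ideal m \<and>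
     (\<forall>M. maximal_ideal M \<longrightarrow> M = m)"

definition has_prime_chain :: "'a::comm_ring_1 itself \<Rightarrow> nat \<Rightarrow> bool" where
  "has_prime_chain _ n \<longleftrightarrow> (\<exists>P :: nat \<Rightarrow> 'a set. (\<forall>i\<le>n. prime_ideal (P i)) \<and> (\<forall>i<n. P i \<subset> P (Suc i)))"

definition krull_dim_eq :: "'a::comm_ring_1 itself \<Rightarrow> nat \<Rightarrow> bool" where
  "krull_dim_eq T d \<longleftrightarrow> has_prime_chain T d \<and> \<not> has_prime_chain T (Suc d)"

definition radical :: "'a::comm_ring_1 set \<Rightarrow> 'a set" where
  "radical I = {x. \<exists>n. x ^ n \<in> I}"

definition primary_ideal :: "'a::comm_ring_1 set \<Rightarrow> bool" where
  "primary_ideal I \<longleftrightarrow> is_ideal I \<and> I \<noteq> UNIV \<and> (\<forall>a b. a * b \<in> I \<and> a \<notin> I \<longrightarrow> (\<exists>n. b ^ n \<in> I))"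

definition m_primary :: "'a::comm_ring_1 set \<Rightarrow> 'a set \<Rightarrow> bool" where
  "m_primary m I \<longleftrightarrow> primary_ideal I \<and> radical I = m"

text \<open>Length \<open>\<ell>_R(R/I)\<close>: the supremum of lengths of strict chains of ideals from \<open>I\<close> to \<open>R\<close>
  (submodules of \<open>R/I\<close> correspond to ideals containing \<open>I\<close>; length of a module = maximal
  length of a strict chain of submodules).\<close>
definition ideal_chain_from :: "'a::comm_ring_1 set \<Rightarrow> nat \<Rightarrow> bool" where
  "ideal_chain_from I n \<longleftrightarrow> (\<exists>J :: nat \<Rightarrow> 'a set. J 0 = I \<and> J n = UNIV \<and>
      (\<forall>i\<le>n. is_ideal (J i)) \<and> (\<forall>i<n. J i \<subset> J (Suc i)))"

definition colength :: "'a::comm_ring_1 set \<Rightarrow> nat" where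
  "colength I = Sup {n. ideal_chain_from I n}"

text \<open>A p-family indexed by exponents: \<open>I e\<close> stands for \<open>I_{p^e}\<close>.\<close>
definition p_family :: "nat \<Rightarrow> (nat \<Rightarrow> 'a::comm_ring_1 set) \<Rightarrow> bool" where
  "p_family p I \<longleftrightarrow> (\<forall>e. is_ideal (I e)) \<and> (\<forall>e. frob_pow p (I e) \<subseteq> I (Suc e))"

definition volume :: "nat \<Rightarrow> nat \<Rightarrow> (nat \<Rightarrow> 'a::comm_ring_1 set) \<Rightarrow> real" where
  "volume p d I = lim (\<lambda>e. real (colength (I e)) / real (p ^ e) ^ d)"

definition zvec :: "nat \<Rightarrow> (nat \<Rightarrow> int) set" where
  "zvec d = {u. \<forall>i\<ge>d. u i = 0}"

definition pair_a :: "nat \<Rightarrow> (nat \<Rightarrow> real) \<Rightarrow> (nat \<Rightarrow> int) \<Rightarrow> real" where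
  "pair_a d a u = (\<Sum>i<d. real_of_int (u i) * a i)"

definition rat_lin_indep :: "nat \<Rightarrow> (nat \<Rightarrow> real) \<Rightarrow> bool" where
  "rat_lin_indep d a \<longleftrightarrow> (\<forall>c :: nat \<Rightarrow> rat. (\<Sum>i<d. of_rat (c i) * a i) = 0 \<longrightarrow> (\<forall>i<d. c i = 0))"

definition is_valuation :: "nat \<Rightarrow> (nat \<Rightarrow> real) \<Rightarrow> ('a::field \<Rightarrow> (nat \<Rightarrow> int)) \<Rightarrow> bool" where
  "is_valuation d a \<nu> \<longleftrightarrow>
     \<nu> ` {x. x \<noteq> 0} = zvec d \<and>
     (\<forall>x y. x \<noteq> 0 \<longrightarrow> y \<noteq> 0 \<longrightarrow> \<nu> (x * y) = (\<lambda>i. \<nu> x i + \<nu> y i)) \<and>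
     (\<forall>x y. x \<noteq> 0 \<longrightarrow> y \<noteq> 0 \<longrightarrow> x + y \<noteq> 0 \<longrightarrow>
        pair_a d a (\<nu> (x + y)) \<ge> min (pair_a d a (\<nu> x)) (pair_a d a (\<nu> y)))"

definition val_ge :: "nat \<Rightarrow> (nat \<Rightarrow> real) \<Rightarrow> ('a::field \<Rightarrow> (nat \<Rightarrow> int)) \<Rightarrow> (nat \<Rightarrow> int) \<Rightarrow> 'a set" where
  "val_ge d a \<nu> u = {0} \<union> {x. x \<noteq> 0 \<and> pair_a d a (\<nu> x) \<ge> pair_a d a u}"

definition val_ring :: "nat \<Rightarrow> (nat \<Rightarrow> real) \<Rightarrow> ('a::field \<Rightarrow> (nat \<Rightarrow> int)) \<Rightarrow> 'a set" where
  "val_ring d a \<nu> = val_ge d a \<nu> (\<lambda>_. 0)"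

definition val_max :: "nat \<Rightarrow> (nat \<Rightarrow> real) \<Rightarrow> ('a::field \<Rightarrow> (nat \<Rightarrow> int)) \<Rightarrow> 'a set" where
  "val_max d a \<nu> = {0} \<union> {x. x \<noteq> 0 \<and> pair_a d a (\<nu> x) > 0}"

text \<open>Closed convex cone in \<open>\<real>^d\<close> generated by a set of integer vectors; closure expressed
  by limits of sequences (componentwise convergence = Euclidean convergence in \<open>\<real>^d\<close>).\<close>
definition cone_gen :: "(nat \<Rightarrow> int) set \<Rightarrow> (nat \<Rightarrow> real) set" where
  "cone_gen S = {u. \<exists>F c. finite F \<and> F \<subseteq> S \<and> (\<forall>v\<in>F. c v \<ge> (0::real)) \<and>
                     u = (\<lambda>i. \<Sum>v\<in>F. c v * real_of_int (v i))}"

definition closed_cone_gen :: "(nat \<Rightarrow> int) set \<Rightarrow> (nat \<Rightarrow> real) set" where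
  "closed_cone_gen S = {u. \<exists>X. (\<forall>k. X k \<in> cone_gen S) \<and> (\<forall>i. (\<lambda>k. X k i) \<longlonglongrightarrow> u i)}"

definition pair_real :: "nat \<Rightarrow> (nat \<Rightarrow> real) \<Rightarrow> (nat \<Rightarrow> real) \<Rightarrow> real" where
  "pair_real d a u = (\<Sum>i<d. u i * a i)"

text \<open>OK valuation relative to the local domain with maximal ideal \<open>m\<close>; \<open>D\<close> embeds in its
  fraction field via \<open>x \<mapsto> Fract x 1\<close>.  Condition (iii) \<open>[\<kappa>_V:\<kappa>] < \<infinity>\<close> is written out as:
  \<open>V/\<mm>_V\<close> is spanned over (the image of) \<open>D\<close> by finitely many elements.\<close>
definition ok_valuation :: "nat \<Rightarrow> (nat \<Rightarrow> real) \<Rightarrow> 'a::idom set \<Rightarrow> ('a fract \<Rightarrow> (nat \<Rightarrow> int)) \<Rightarrow> bool" where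
  "ok_valuation d a m \<nu> \<longleftrightarrow>
     is_valuation d a \<nu> \<and>
     (\<forall>x. Fract x 1 \<in> val_ring d a \<nu>) \<and>
     (\<forall>x. x \<in> m \<longleftrightarrow> Fract x 1 \<in> val_max d a \<nu>) \<and>
     (\<forall>u\<in>closed_cone_gen (\<nu> ` {Fract x 1 | x. x \<noteq> 0}). u \<noteq> (\<lambda>_. 0) \<longrightarrow> pair_real d a u > 0) \<and>
     (\<exists>B. finite B \<and> B \<subseteq> val_ring d a \<nu> \<and>
        (\<forall>y\<in>val_ring d a \<nu>. \<exists>c. y - (\<Sum>b\<in>B. Fract (c b) 1 * b) \<in> val_max d a \<nu>)) \<and>
     (\<exists>v\<in>zvec d. \<forall>n x. Fract x 1 \<in> val_ge d a \<nu> (\<lambda>i. int n * v i) \<longrightarrow> x \<in> ideal_pow m n)"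

definition ok_domain :: "nat \<Rightarrow> (nat \<Rightarrow> real) \<Rightarrow> 'a::idom set \<Rightarrow> bool" where
  "ok_domain d a m \<longleftrightarrow> (\<exists>\<nu>. ok_valuation d a m \<nu>)"

end

theory Submission
  imports Defs "HOL-Library.Function_Algebras" "HOL-Library.FuncSet"
    "HOL-Computational_Algebra.Polynomial_Factorial"
begin

text \<open>
  Write \<open>S = \<nu>(R - 0)\<close> and \<open>T\<^sub>e = \<nu>(I\<^sub>q - 0)\<close> for \<open>q = p\<^sup>e\<close>. The colength of an ideal is a sum over the values
  \<open>t\<close> of \<open>R\<close> of the codimension of its graded piece of value \<open>t\<close> over the residue field; that codimension
  is mostly \<open>[\<kappa>\<^sub>V : \<kappa>]\<close> off the value set of the ideal and \<open>0\<close> on it. So up to \<open>O(q\<^sup>d\<^sup>-\<^sup>1)\<close> the colength of \<open>I\<^sub>q\<close>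
  is \<open>[\<kappa>\<^sub>V : \<kappa>]\<close> times the number of points of \<open>S - T\<^sub>e\<close>, all of which satisfy \<open>\<langle>u, a\<rangle> < c q\<close> for a fixed \<open>c\<close>.
  Since \<open>S\<close> generates \<open>\<int>\<^sup>d\<close>, every point of \<open>T\<^sub>e\<close> produces a full box of \<open>p\<^sup>k\<^sup>d\<close> points of \<open>T\<^bsub>e+k\<^esub>\<close>, and the
  normalised counts increase up to an error \<open>O(1/q)\<close>; so the volume exists as a limit.

  If \<open>I\<close> at level \<open>q q\<^sub>0\<close> lies in \<open>m\<^bsup>[q]\<^esup>\<close>, its values are at least \<open>q \<delta>\<close>, so a fixed proportion of \<open>S\<close> is
  missed and the volume is positive. Otherwise, as all elements of value at least \<open>q \<kappa>\<close> lie in \<open>m\<^bsup>[q]\<^esup>\<close>, for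
  every \<open>q\<^sub>0\<close> there are \<open>q\<close> and a value \<open>w\<close> of \<open>I\<close> at level \<open>q q\<^sub>0\<close> with \<open>\<langle>w, a\<rangle> < q \<kappa>\<close>. The translates of \<open>S\<close>
  by multiples of \<open>w\<close> leave out only a slab of relative width \<open>\<kappa>/q\<^sub>0\<close>, and the volume vanishes.
\<close>

section \<open>Lattice points in a weighted monoid\<close>

lemma pair_a_zero [simp]: "pair_a d a 0 = 0"
  by (simp add: pair_a_def)

lemma pair_a_add [simp]: "pair_a d a (u + v) = pair_a d a u + pair_a d a v"
  by (simp add: pair_a_def distrib_right sum.distrib)

lemma pair_a_of_nat_mult [simp]: "pair_a d a (of_nat n * u) = real n * pair_a d a u"
  by (simp add: pair_a_def sum_distrib_left mult.assoc)

lemma pair_a_fun_upd: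
  assumes "k < d"
  shows "pair_a d a (u(k := j)) = pair_a d a u + real_of_int (j - u k) * a k"
proof -
  have "pair_a d a (u(k := j)) - pair_a d a u = (\<Sum>i<d. if i = k then real_of_int (j - u k) * a k else 0)"
    unfolding pair_a_def sum_subtractf[symmetric]
    by (intro sum.cong) (simp_all add: left_diff_distrib)
  then show ?thesis
    using assms by simp
qed

lemma pair_a_inj_on:
  assumes "rat_lin_indep d a"
  shows "inj_on (pair_a d a) (zvec d)"
proof (rule inj_onI, rule ext)
  fix u v i
  assume zvec: "u \<in> zvec d" "v \<in> zvec d" and eq: "pair_a d a u = pair_a d a v"
  have "(\<Sum>i<d. of_rat (rat_of_int (u i - v i)) * a i) = 0"
    using eq by (simp add: pair_a_def of_rat_diff left_diff_distrib sum_subtractf)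
  then have "\<forall>i<d. rat_of_int (u i - v i) = 0"
    using assms[unfolded rat_lin_indep_def, rule_format, of "\<lambda>i. rat_of_int (u i - v i)"] by blast
  then show "u i = v i"
    using zvec by (cases "i < d") (auto simp: zvec_def)
qed

definition lattice_box :: "nat set \<Rightarrow> int set \<Rightarrow> (nat \<Rightarrow> int) set" where
  "lattice_box I A = {u. (\<forall>i\<in>I. u i \<in> A) \<and> (\<forall>i. i \<notin> I \<longrightarrow> u i = 0)}"

lemma
  assumes "finite I" and "finite A"
  shows finite_lattice_box: "finite (lattice_box I A)"
    and card_lattice_box: "card (lattice_box I A) = card A ^ card I"
proof -
  have bij: "bij_betw (\<lambda>u. restrict u I) (lattice_box I A) (I \<rightarrow>\<^sub>E A)"
    by (rule bij_betw_byWitness[where f' = "\<lambda>u i. if i \<in> I then u i else 0"])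
      (auto simp: lattice_box_def fun_eq_iff PiE_iff extensional_def)
  show "finite (lattice_box I A)"
    using bij_betw_finite[OF bij] assms by (simp add: finite_PiE)
  show "card (lattice_box I A) = card A ^ card I"
    using bij_betw_same_card[OF bij] assms by (simp add: card_funcsetE)
qed

lemma pair_a_lattice_box_le:
  assumes "t \<in> lattice_box {..<d} {0..<int n}"
  shows "pair_a d a t \<le> real n * (\<Sum>i<d. \<bar>a i\<bar>)"
proof -
  have "real_of_int (t i) * a i \<le> real n * \<bar>a i\<bar>" if "i < d" for i
  proof -
    have "0 \<le> t i" "t i \<le> int n"
      using assms that by (auto simp: lattice_box_def less_imp_le)
    then have "\<bar>real_of_int (t i)\<bar> \<le> real n"
      by linarith
    then have "\<bar>real_of_int (t i) * a i\<bar> \<le> real n * \<bar>a i\<bar>"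
      by (simp add: abs_mult mult_right_mono)
    then show ?thesis
      by linarith
  qed
  then show ?thesis
    unfolding pair_a_def sum_distrib_left by (intro sum_mono) auto
qed

lemma inj_on_lattice_tiling:
  assumes "0 < n"
  shows "inj_on (\<lambda>(u, t). of_nat n * u + t) (A \<times> lattice_box I {0..<int n})"
proof (rule inj_onI, clarify)
  fix u t u' t'
  assume "t \<in> lattice_box I {0..<int n}" and "t' \<in> lattice_box I {0..<int n}"
    and eq: "of_nat n * u + t = of_nat n * u' + t'"
  then have t: "0 \<le> t i" "t i < int n" and t': "0 \<le> t' i" "t' i < int n" for i
    using assms unfolding lattice_box_def by (cases "i \<in> I"; auto)+
  have coord: "int n * u i + t i = int n * u' i + t' i" for i
    using fun_cong[OF eq, of i] by simp
  have "u i = u' i" for i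
  proof -
    have "(int n * u i + t i) div int n = u i" "(int n * u' i + t' i) div int n = u' i"
      using t t' assms by simp_all
    then show ?thesis
      using coord by metis
  qed
  then show "u = u' \<and> t = t'"
    using coord by auto
qed

lemma
  fixes \<alpha> :: real
  assumes "\<alpha> \<noteq> 0" and "s \<le> t"
  shows finite_int_affine: "finite {k::int. s \<le> z + real_of_int k * \<alpha> \<and> z + real_of_int k * \<alpha> < t}"
    and card_int_affine_le:
      "real (card {k::int. s \<le> z + real_of_int k * \<alpha> \<and> z + real_of_int k * \<alpha> < t}) \<le> (t - s) / \<bar>\<alpha>\<bar> + 1"
proof -
  let ?K = "{k::int. s \<le> z + real_of_int k * \<alpha> \<and> z + real_of_int k * \<alpha> < t}"
  define lo where "lo = min ((s - z) / \<alpha>) ((t - z) / \<alpha>)"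
  define hi where "hi = max ((s - z) / \<alpha>) ((t - z) / \<alpha>)"
  have width: "hi - lo = (t - s) / \<bar>\<alpha>\<bar>"
    using assms unfolding lo_def hi_def by (cases "0 < \<alpha>") (auto simp: min_def max_def field_simps)
  have sub: "?K \<subseteq> {\<lceil>lo\<rceil>..\<lfloor>hi\<rfloor>}"
    using assms unfolding lo_def hi_def
    by (cases "0 < \<alpha>") (auto simp: min_def max_def field_simps ceiling_le_iff le_floor_iff)
  then show "finite ?K"
    by (rule finite_subset) simp
  have "card ?K \<le> nat (\<lfloor>hi\<rfloor> - \<lceil>lo\<rceil> + 1)"
    using card_mono[OF _ sub] by simp
  also have "real \<dots> \<le> hi - lo + 1"
  proof -
    have "0 \<le> hi - lo"
      unfolding width using assms by simp
    then show ?thesis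
      by linarith
  qed
  finally show "real (card ?K) \<le> (t - s) / \<bar>\<alpha>\<bar> + 1"
    by (simp add: width)
qed

lemma card_symmetric_interval_le:
  assumes "0 \<le> x"
  shows "real (card {- \<lfloor>x\<rfloor>..\<lfloor>x\<rfloor>}) \<le> 2 * x + 1"
proof -
  have "real (card {- \<lfloor>x\<rfloor>..\<lfloor>x\<rfloor>}) = 2 * real_of_int \<lfloor>x\<rfloor> + 1"
    using assms by simp
  then show ?thesis
    using of_int_floor_le[of x] by linarith
qed

lemma card_le_card_times_fibre:
  assumes "finite E" and "finite B" and "g ` E \<subseteq> B"
    and "\<And>y. y \<in> B \<Longrightarrow> real (card {x \<in> E. g x = y}) \<le> l"
  shows "real (card E) \<le> real (card B) * l"
proof -
  have "real (card E) = (\<Sum>y\<in>B. real (card {x \<in> E. g x = y}))"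
    using sum.group[OF assms(1-3), of "\<lambda>_. 1 :: real"] by simp
  also have "\<dots> \<le> (\<Sum>y\<in>B. l)"
    using assms(4) by (rule sum_mono)
  finally show ?thesis
    by simp
qed

lemma sum_fun_apply: "(\<Sum>i\<in>A. f i) x = (\<Sum>i\<in>A. f i x)"
  by (induction A rule: infinite_finite_induct) simp_all

lemma translated_box_decomposition:
  fixes s s' :: "nat \<Rightarrow> nat \<Rightarrow> int" and k :: "nat \<Rightarrow> nat"
  assumes "t \<in> zvec d" and k: "\<And>i. i < d \<Longrightarrow> t i = int (k i)" "\<And>i. i < d \<Longrightarrow> k i \<le> n"
    and diff: "\<And>i. i < d \<Longrightarrow> s i - s' i = (\<lambda>j. of_bool (j = i))"
  shows "of_nat n * sum s' {..<d} + t = (\<Sum>i<d. of_nat (k i) * s i + of_nat (n - k i) * s' i)"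
proof
  fix j
  have "(of_nat (k i) * s i + of_nat (n - k i) * s' i) j = int n * s' i j + (if j = i then t i else 0)"
    if "i < d" for i
  proof -
    have "s i j = s' i j + of_bool (j = i)"
      using fun_cong[OF diff[OF that], of j] by simp
    then show ?thesis
      using k(1)[OF that] k(2)[OF that] by (simp add: of_nat_diff algebra_simps)
  qed
  then have "(\<Sum>i<d. of_nat (k i) * s i + of_nat (n - k i) * s' i) j
      = (\<Sum>i<d. int n * s' i j + (if j = i then t i else 0))"
    unfolding sum_fun_apply by (intro sum.cong) auto
  also have "\<dots> = int n * (\<Sum>i<d. s' i j) + (\<Sum>i<d. if j = i then t i else 0)"
    by (simp only: sum.distrib sum_distrib_left)
  also have "(\<Sum>i<d. if j = i then t i else 0) = t j"
    using assms(1) by (auto simp: zvec_def)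
  finally show "(of_nat n * sum s' {..<d} + t) j = (\<Sum>i<d. of_nat (k i) * s i + of_nat (n - k i) * s' i) j"
    by (simp add: sum_fun_apply)
qed

locale weighted_monoid =
  fixes d :: nat and a :: "nat \<Rightarrow> real" and S :: "(nat \<Rightarrow> int) set"
  assumes dim_pos: "0 < d"
    and subset_zvec: "S \<subseteq> zvec d"
    and zero_mem: "0 \<in> S"
    and add_mem: "u \<in> S \<Longrightarrow> v \<in> S \<Longrightarrow> u + v \<in> S"
    and unit_vector_eq_diff: "i < d \<Longrightarrow> \<exists>s\<in>S. \<exists>s'\<in>S. s - s' = (\<lambda>j. of_bool (j = i))"
    and coercive: "\<exists>\<epsilon>>0. \<forall>u\<in>S. \<forall>i<d. \<epsilon> * \<bar>real_of_int (u i)\<bar> \<le> pair_a d a u"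
begin

abbreviation wt :: "(nat \<Rightarrow> int) \<Rightarrow> real" where
  "wt \<equiv> pair_a d a"

definition count_below :: "(nat \<Rightarrow> int) set \<Rightarrow> real \<Rightarrow> nat" where
  "count_below A t = card {u \<in> A. wt u < t}"

lemma wt_nonneg:
  assumes "u \<in> S"
  shows "0 \<le> wt u"
proof -
  obtain \<epsilon> where "0 < \<epsilon>" "\<epsilon> * \<bar>real_of_int (u 0)\<bar> \<le> wt u"
    using coercive assms dim_pos by blast
  moreover have "0 \<le> \<epsilon> * \<bar>real_of_int (u 0)\<bar>"
    using \<open>0 < \<epsilon>\<close> by simp
  ultimately show ?thesis
    by linarith
qed

lemma of_nat_mult_mem: "u \<in> S \<Longrightarrow> of_nat n * u \<in> S"
  by (induction n) (auto simp: zero_mem distrib_right intro: add_mem)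

lemma sum_mem: "(\<And>j. j \<in> A \<Longrightarrow> f j \<in> S) \<Longrightarrow> sum f A \<in> S"
  by (induction A rule: infinite_finite_induct) (auto simp: zero_mem intro: add_mem)

lemma ex_nonzero_weight: "\<exists>k<d. a k \<noteq> 0"
proof (rule ccontr)
  assume "\<not> ?thesis"
  then have wt_eq_0: "wt u = 0" for u
    by (simp add: pair_a_def)
  obtain \<epsilon> where \<epsilon>: "0 < \<epsilon>" "\<forall>u\<in>S. \<epsilon> * \<bar>real_of_int (u 0)\<bar> \<le> wt u"
    using coercive dim_pos by blast
  have vanish: "u 0 = 0" if "u \<in> S" for u
    using \<epsilon>(2)[rule_format, OF that] \<epsilon>(1) by (simp add: wt_eq_0 mult_le_0_iff)
  obtain s s' where s: "s \<in> S" "s' \<in> S" "s - s' = (\<lambda>j. of_bool (j = 0))"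
    using unit_vector_eq_diff[OF dim_pos] by blast
  show False
    using fun_cong[OF s(3), of 0] vanish[OF s(1)] vanish[OF s(2)] by simp
qed

lemma coordinates_bounded:
  "\<exists>\<epsilon>>0. \<forall>u\<in>S. \<forall>t>wt u. \<forall>i<d. u i \<in> {- \<lfloor>t / \<epsilon>\<rfloor>..\<lfloor>t / \<epsilon>\<rfloor>}"
proof -
  obtain \<epsilon> where \<epsilon>: "0 < \<epsilon>" "\<And>u i. u \<in> S \<Longrightarrow> i < d \<Longrightarrow> \<epsilon> * \<bar>real_of_int (u i)\<bar> \<le> wt u"
    using coercive by blast
  have "u i \<in> {- \<lfloor>t / \<epsilon>\<rfloor>..\<lfloor>t / \<epsilon>\<rfloor>}" if "u \<in> S" "wt u < t" "i < d" for u t i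
  proof -
    have "real_of_int \<bar>u i\<bar> * \<epsilon> \<le> t"
      using \<epsilon>(2)[OF that(1,3)] that(2) by (simp add: mult.commute)
    then have "\<bar>u i\<bar> \<le> \<lfloor>t / \<epsilon>\<rfloor>"
      using \<epsilon>(1) by (simp add: le_floor_iff pos_le_divide_eq)
    then show ?thesis
      by auto
  qed
  with \<epsilon>(1) show ?thesis
    by (intro exI[of _ \<epsilon>]) simp
qed

lemma finite_below:
  assumes "A \<subseteq> S"
  shows "finite {u \<in> A. wt u < t}"
proof -
  obtain \<epsilon> where \<epsilon>: "\<And>u t i. u \<in> S \<Longrightarrow> wt u < t \<Longrightarrow> i < d \<Longrightarrow> u i \<in> {- \<lfloor>t / \<epsilon>\<rfloor>..\<lfloor>t / \<epsilon>\<rfloor>}"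
    using coordinates_bounded by blast
  have "{u \<in> A. wt u < t} \<subseteq> lattice_box {..<d} {- \<lfloor>t / \<epsilon>\<rfloor>..\<lfloor>t / \<epsilon>\<rfloor>}"
  proof
    fix u
    assume "u \<in> {u \<in> A. wt u < t}"
    then have "u \<in> S" "wt u < t"
      using assms by auto
    then show "u \<in> lattice_box {..<d} {- \<lfloor>t / \<epsilon>\<rfloor>..\<lfloor>t / \<epsilon>\<rfloor>}"
      using \<epsilon> subset_zvec by (auto simp: lattice_box_def zvec_def simp del: atLeastAtMost_iff)
  qed
  then show ?thesis
    by (rule finite_subset) (simp add: finite_lattice_box)
qed

text \<open>Project along a coordinate \<open>k\<close> with \<open>a k \<noteq> 0\<close>: the image lies in a box, and each fibre is
  an interval.\<close>

lemma card_slab_le_box: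
  assumes k: "k < d" "a k \<noteq> 0" and "s \<le> t" and "finite A"
    and box: "\<And>u i. u \<in> S \<Longrightarrow> wt u < t \<Longrightarrow> i < d \<Longrightarrow> u i \<in> A"
  shows "real (card {u \<in> S. s \<le> wt u \<and> wt u < t}) \<le> real (card A) ^ (d - 1) * ((t - s) / \<bar>a k\<bar> + 1)"
proof -
  define E where "E = {u \<in> S. s \<le> wt u \<and> wt u < t}"
  define B where "B = lattice_box ({..<d} - {k}) A"
  have "real (card E) \<le> real (card B) * ((t - s) / \<bar>a k\<bar> + 1)"
  proof (rule card_le_card_times_fibre)
    show "finite E"
      unfolding E_def by (rule finite_subset[OF _ finite_below[of S t]]) auto
    show "finite B"
      unfolding B_def by (simp add: finite_lattice_box assms(4))
    show "(\<lambda>u. u(k := 0)) ` E \<subseteq> B"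
      using box subset_zvec by (fastforce simp: E_def B_def lattice_box_def zvec_def)
    fix y
    let ?fibre = "{u \<in> E. u(k := 0) = y}"
    let ?J = "{j. s \<le> wt y + real_of_int j * a k \<and> wt y + real_of_int j * a k < t}"
    have "inj_on (\<lambda>u. u k) ?fibre"
      by (rule inj_onI) (metis (mono_tags, lifting) fun_upd_triv fun_upd_upd mem_Collect_eq)
    moreover have "(\<lambda>u. u k) ` ?fibre \<subseteq> ?J"
      using pair_a_fun_upd[OF k(1), of a _ 0] by (auto simp: E_def)
    ultimately have "card ?fibre \<le> card ?J"
      using finite_int_affine[OF k(2) assms(3)] by (rule card_inj_on_le)
    then show "real (card ?fibre) \<le> (t - s) / \<bar>a k\<bar> + 1"
      using card_int_affine_le[OF k(2) assms(3), of "wt y"] by linarith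
  qed
  then show ?thesis
    using k(1) by (simp add: E_def B_def card_lattice_box assms(4))
qed

lemma card_slab_le:
  "\<exists>K>0. \<forall>r s t. 1 \<le> r \<longrightarrow> s \<le> t \<longrightarrow> t \<le> r \<longrightarrow>
     real (card {u \<in> S. s \<le> wt u \<and> wt u < t}) \<le> K * r ^ (d - 1) * (t - s + 1)"
proof -
  obtain k where k: "k < d" "a k \<noteq> 0"
    using ex_nonzero_weight by blast
  obtain \<epsilon> where \<epsilon>: "0 < \<epsilon>"
    "\<And>u t i. u \<in> S \<Longrightarrow> wt u < t \<Longrightarrow> i < d \<Longrightarrow> u i \<in> {- \<lfloor>t / \<epsilon>\<rfloor>..\<lfloor>t / \<epsilon>\<rfloor>}"
    using coordinates_bounded by blast
  define w where "w = max (1 / \<bar>a k\<bar>) 1"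
  define K where "K = (2 / \<epsilon> + 1) ^ (d - 1) * w"
  have "real (card {u \<in> S. s \<le> wt u \<and> wt u < t}) \<le> K * r ^ (d - 1) * (t - s + 1)"
    if r: "1 \<le> r" "s \<le> t" "t \<le> r" for r s t
  proof -
    define A where "A = {- \<lfloor>r / \<epsilon>\<rfloor>..\<lfloor>r / \<epsilon>\<rfloor>}"
    have "real (card A) \<le> 2 * (r / \<epsilon>) + r"
      using card_symmetric_interval_le[of "r / \<epsilon>"] r(1) \<epsilon>(1) by (simp add: A_def)
    then have side: "real (card A) ^ (d - 1) \<le> ((2 / \<epsilon> + 1) * r) ^ (d - 1)"
      by (intro power_mono) (simp_all add: algebra_simps)
    have "(t - s) / \<bar>a k\<bar> \<le> w * (t - s)"
      using mult_right_mono[of "1 / \<bar>a k\<bar>" w "t - s"] r(2) by (simp add: w_def)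
    then have height: "(t - s) / \<bar>a k\<bar> + 1 \<le> w * (t - s + 1)"
      by (simp add: distrib_left w_def)
    have "u i \<in> A" if "u \<in> S" "wt u < t" "i < d" for u i
      unfolding A_def using \<epsilon>(2)[OF that(1) _ that(3)] that(2) r(3) by (meson less_le_trans)
    then have "real (card {u \<in> S. s \<le> wt u \<and> wt u < t}) \<le> real (card A) ^ (d - 1) * ((t - s) / \<bar>a k\<bar> + 1)"
      by (intro card_slab_le_box[OF k r(2)]) (simp_all add: A_def)
    also have "\<dots> \<le> ((2 / \<epsilon> + 1) * r) ^ (d - 1) * (w * (t - s + 1))"
      using r \<epsilon>(1) by (intro mult_mono side height) simp_all
    finally show ?thesis
      by (simp add: K_def power_mult_distrib mult_ac)
  qed
  moreover have "0 < K"
    unfolding K_def w_def using \<epsilon>(1) by (intro mult_pos_pos zero_less_power add_pos_pos) auto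
  ultimately show ?thesis
    by blast
qed

definition slab_const :: real where
  "slab_const = (SOME K. 0 < K \<and> (\<forall>r s t. 1 \<le> r \<longrightarrow> s \<le> t \<longrightarrow> t \<le> r \<longrightarrow>
     real (card {u \<in> S. s \<le> wt u \<and> wt u < t}) \<le> K * r ^ (d - 1) * (t - s + 1)))"

lemma
  shows slab_const_pos: "0 < slab_const"
    and card_slab_le_slab_const: "1 \<le> r \<Longrightarrow> s \<le> t \<Longrightarrow> t \<le> r \<Longrightarrow>
      real (card {u \<in> S. s \<le> wt u \<and> wt u < t}) \<le> slab_const * r ^ (d - 1) * (t - s + 1)"
  using someI_ex[OF card_slab_le] unfolding slab_const_def[symmetric] by blast+

lemma count_below_le_slab:
  assumes "A \<subseteq> S" and "1 \<le> r" and "s \<le> t" and "t \<le> r"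
  shows "real (count_below A t) \<le> real (count_below A s) + slab_const * r ^ (d - 1) * (t - s + 1)"
proof -
  have "finite {u \<in> S. s \<le> wt u \<and> wt u < t}"
    by (rule finite_subset[OF _ finite_below[of S t]]) auto
  moreover have "{u \<in> A. wt u < t} \<subseteq> {u \<in> A. wt u < s} \<union> {u \<in> S. s \<le> wt u \<and> wt u < t}"
    using assms(1) by auto
  ultimately have "count_below A t \<le> card ({u \<in> A. wt u < s} \<union> {u \<in> S. s \<le> wt u \<and> wt u < t})"
    unfolding count_below_def using finite_below[OF assms(1)] by (intro card_mono) auto
  also have "\<dots> \<le> count_below A s + card {u \<in> S. s \<le> wt u \<and> wt u < t}"
    unfolding count_below_def by (rule card_Un_le)
  finally show ?thesis
    using card_slab_le_slab_const[OF assms(2-4)] by linarith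
qed

lemma count_below_mono: "A \<subseteq> B \<Longrightarrow> B \<subseteq> S \<Longrightarrow> s \<le> t \<Longrightarrow> count_below A s \<le> count_below B t"
  unfolding count_below_def by (intro card_mono finite_below) auto

lemma count_below_translate: "count_below ((+) v ` A) t = count_below A (t - wt v)"
proof -
  have "{u \<in> (+) v ` A. wt u < t} = (+) v ` {u \<in> A. wt u < t - wt v}"
    by auto
  then show ?thesis
    by (simp add: count_below_def card_image)
qed

lemma ex_translated_boxes_subset:
  "\<exists>b\<in>S. \<forall>n. \<forall>t\<in>lattice_box {..<d} {0..<int n}. of_nat n * b + t \<in> S"
proof -
  have "\<forall>i. \<exists>s s'. i < d \<longrightarrow> s \<in> S \<and> s' \<in> S \<and> s - s' = (\<lambda>j. of_bool (j = i))"
    using unit_vector_eq_diff by blast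
  then obtain s s' where s: "\<And>i. i < d \<Longrightarrow> s i \<in> S" "\<And>i. i < d \<Longrightarrow> s' i \<in> S"
    and diff: "\<And>i. i < d \<Longrightarrow> s i - s' i = (\<lambda>j. of_bool (j = i))"
    by metis
  have "of_nat n * sum s' {..<d} + t \<in> S" if t: "t \<in> lattice_box {..<d} {0..<int n}" for n t
  proof -
    have "of_nat n * sum s' {..<d} + t = (\<Sum>i<d. of_nat (nat (t i)) * s i + of_nat (n - nat (t i)) * s' i)"
      using t by (intro translated_box_decomposition diff)
        (auto simp: lattice_box_def zvec_def nat_le_iff less_imp_le)
    also have "\<dots> \<in> S"
      using s by (intro sum_mem add_mem of_nat_mult_mem) auto
    finally show ?thesis .
  qed
  moreover have "sum s' {..<d} \<in> S"
    using s(2) by (intro sum_mem) auto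
  ultimately show ?thesis
    by blast
qed

end

lemma inverse_power_tendsto_0:
  assumes "1 < p"
  shows "(\<lambda>e. C / real p ^ e) \<longlonglongrightarrow> 0"
  using LIMSEQ_divide_realpow_zero[of "real p" C] assms by simp

lemma convergent_if_almost_increasing:
  fixes X Y :: "nat \<Rightarrow> real"
  assumes bounded: "\<And>n. X n \<le> B" and error: "Y \<longlonglongrightarrow> 0"
    and increasing: "\<And>n k. X n - Y n \<le> X (n + k)"
  shows "convergent X"
proof -
  define l where "l = (SUP n. X n - Y n)"
  have bdd: "bdd_above (range (\<lambda>n. X n - Y n))"
    using increasing bounded by (intro bdd_aboveI[of _ B]) (fastforce intro: order_trans)
  have "X \<longlonglongrightarrow> l"
  proof (rule LIMSEQ_I)
    fix r :: real
    assume "0 < r"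
    then obtain n where n: "l - r < X n - Y n"
      using less_cSup_iff[OF _ bdd, of "l - r"] unfolding l_def by auto
    obtain N where N: "\<And>k. N \<le> k \<Longrightarrow> \<bar>Y k\<bar> < r"
      using LIMSEQ_D[OF error \<open>0 < r\<close>] by auto
    have "\<bar>X k - l\<bar> < r" if "max n N \<le> k" for k
    proof -
      have "X n - Y n \<le> X k"
        using increasing[of n "k - n"] that by simp
      moreover have "X k - Y k \<le> l"
        unfolding l_def using bdd by (intro cSup_upper) auto
      ultimately show ?thesis
        using n N[of k] that by auto
    qed
    then show "\<exists>no. \<forall>k\<ge>no. norm (X k - l) < r"
      by (intro exI[of _ "max n N"]) simp
  qed
  then show ?thesis
    by (rule convergentI)
qed

context weighted_monoid
begin

definition p_system :: "nat \<Rightarrow> (nat \<Rightarrow> (nat \<Rightarrow> int) set) \<Rightarrow> bool" where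
  "p_system p T \<longleftrightarrow> (\<forall>e. T e \<subseteq> S) \<and> (\<forall>e. \<forall>u\<in>T e. \<forall>v\<in>S. u + v \<in> T e) \<and>
     (\<forall>e. \<forall>u\<in>T e. of_nat p * u \<in> T (Suc e))"

lemma p_system_subset: "p_system p T \<Longrightarrow> T e \<subseteq> S"
  by (simp add: p_system_def)

lemma p_system_add: "p_system p T \<Longrightarrow> u \<in> T e \<Longrightarrow> v \<in> S \<Longrightarrow> u + v \<in> T e"
  by (simp add: p_system_def)

lemma p_system_mult: "p_system p T \<Longrightarrow> u \<in> T e \<Longrightarrow> of_nat p * u \<in> T (Suc e)"
  by (simp add: p_system_def)

lemma p_system_const: "p_system p (\<lambda>_. S)"
  by (simp add: p_system_def add_mem of_nat_mult_mem)

lemma p_system_power_mult: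
  assumes "p_system p T" and "u \<in> T e"
  shows "of_nat (p ^ k) * u \<in> T (e + k)"
proof (induction k)
  case (Suc k)
  have "of_nat p * (of_nat (p ^ k) * u) \<in> T (Suc (e + k))"
    by (rule p_system_mult[OF assms(1) Suc])
  then show ?case
    by (simp only: power_Suc of_nat_mult mult.assoc add_Suc_right)
qed (use assms in simp)

lemma p_system_tile_mem:
  assumes T: "p_system p T" and u: "u \<in> T e" and "of_nat (p ^ k) * b + x \<in> S"
  shows "of_nat (p ^ k) * (b + u) + x \<in> T (e + k)"
proof -
  have "of_nat (p ^ k) * (b + u) + x = of_nat (p ^ k) * u + (of_nat (p ^ k) * b + x)"
    by (simp only: distrib_left add_ac)
  also have "\<dots> \<in> T (e + k)"
    by (intro p_system_add[OF T p_system_power_mult[OF T u]] assms(3))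
  finally show ?thesis .
qed

text \<open>Each \<open>u \<in> T e\<close> contributes the full box \<open>p\<^sup>k (u + b) + [0, p\<^sup>k)\<^sup>d\<close> to \<open>T (e + k)\<close>.\<close>

lemma count_below_tiling_le:
  assumes T: "p_system p T" and "0 < p"
    and boxes: "\<And>x. x \<in> lattice_box {..<d} {0..<int (p ^ k)} \<Longrightarrow> of_nat (p ^ k) * b + x \<in> S"
  shows "count_below (T e) (t - (wt b + (\<Sum>i<d. \<bar>a i\<bar>))) * (p ^ k) ^ d
    \<le> count_below (T (e + k)) (real p ^ k * t)"
proof -
  define n where "n = p ^ k"
  have "0 < n"
    using \<open>0 < p\<close> by (simp add: n_def)
  define \<beta> where "\<beta> = wt b + (\<Sum>i<d. \<bar>a i\<bar>)"
  define G where "G = (+) b ` {u \<in> T e. wt u < t - \<beta>}"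
  define Box where "Box = lattice_box {..<d} {0..<int n}"
  have "(\<lambda>(u, x). of_nat n * u + x) ` (G \<times> Box) \<subseteq> {u \<in> T (e + k). wt u < real n * t}"
  proof clarify
    fix u x
    assume "u \<in> G" and x: "x \<in> Box"
    then obtain u' where u': "u' \<in> T e" "wt u' < t - \<beta>" "u = b + u'"
      by (auto simp: G_def)
    have "wt (of_nat n * u + x) \<le> real n * (wt u' + \<beta>)"
      using pair_a_lattice_box_le[of x d n] x by (simp add: u'(3) \<beta>_def Box_def distrib_left)
    also have "\<dots> < real n * t"
      using u'(2) \<open>0 < n\<close> by (intro mult_strict_left_mono) auto
    finally show "of_nat n * u + x \<in> T (e + k) \<and> wt (of_nat n * u + x) < real n * t"
      using p_system_tile_mem[OF T u'(1)] boxes x unfolding n_def u'(3) Box_def by blast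
  qed
  then have "card (G \<times> Box) \<le> count_below (T (e + k)) (real n * t)"
    unfolding count_below_def Box_def
    by (intro card_inj_on_le[OF inj_on_lattice_tiling[OF \<open>0 < n\<close>]] finite_below p_system_subset[OF T])
  moreover have "card G = count_below (T e) (t - \<beta>)"
    unfolding G_def count_below_def by (simp add: card_image)
  moreover have "card Box = n ^ d"
    by (simp add: Box_def card_lattice_box)
  ultimately show ?thesis
    by (simp add: card_cartesian_product n_def \<beta>_def)
qed

lemma ex_tiling_loss:
  "\<exists>\<beta>\<ge>0. \<forall>p T e k t. p_system p T \<longrightarrow> 0 < p \<longrightarrow>
     count_below (T e) (t - \<beta>) * (p ^ k) ^ d \<le> count_below (T (e + k)) (real p ^ k * t)"
proof -
  obtain b where b: "b \<in> S" "\<And>n t. t \<in> lattice_box {..<d} {0..<int n} \<Longrightarrow> of_nat n * b + t \<in> S"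
    using ex_translated_boxes_subset by blast
  then have "0 \<le> wt b + (\<Sum>i<d. \<bar>a i\<bar>)"
    using wt_nonneg by (simp add: sum_nonneg)
  then show ?thesis
    using count_below_tiling_le b(2) by blast
qed

definition density :: "nat \<Rightarrow> real \<Rightarrow> (nat \<Rightarrow> (nat \<Rightarrow> int) set) \<Rightarrow> nat \<Rightarrow> real" where
  "density p c T e = real (count_below (T e) (c * real p ^ e)) / (real p ^ e) ^ d"

definition slab_rate :: "real \<Rightarrow> real" where
  "slab_rate c = slab_const * c ^ (d - 1)"

lemma slab_rate_pos: "1 \<le> c \<Longrightarrow> 0 < slab_rate c"
  unfolding slab_rate_def using slab_const_pos by simp

lemma count_below_ratio_le_slab:
  assumes "A \<subseteq> S" and "1 \<le> c" and "1 \<le> q" and "0 \<le> \<beta>"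
  shows "real (count_below A (c * q)) / q ^ d
    \<le> real (count_below A (c * q - \<beta>)) / q ^ d + slab_rate c * (\<beta> + 1) / q"
proof -
  have "1 \<le> c * q"
    using assms(2,3) mult_mono[of 1 c 1 q] by simp
  then have "real (count_below A (c * q)) / q ^ d \<le>
      (real (count_below A (c * q - \<beta>)) + slab_const * (c * q) ^ (d - 1) * (\<beta> + 1)) / q ^ d"
    using count_below_le_slab[OF assms(1), of "c * q" "c * q - \<beta>" "c * q"] assms(3,4)
    by (intro divide_right_mono) auto
  moreover have "q ^ d = q ^ (d - 1) * q"
    using dim_pos by (rule power_minus_mult[symmetric])
  then have "slab_const * (c * q) ^ (d - 1) * (\<beta> + 1) / q ^ d = slab_rate c * (\<beta> + 1) / q"
    using assms(3) by (simp add: slab_rate_def power_mult_distrib)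
  ultimately show ?thesis
    by (simp add: add_divide_distrib)
qed

lemma density_le:
  assumes "p_system p T" and "1 < p" and "1 \<le> c"
  shows "density p c T e \<le> slab_rate c * (c + 1)"
proof -
  let ?q = "real p ^ e"
  have q: "1 \<le> ?q"
    using assms(2) by simp
  have "{u \<in> T e. wt u < 0} = {}"
    using p_system_subset[OF assms(1), of e] wt_nonneg by force
  then have "count_below (T e) (c * ?q - c * ?q) = 0"
    by (simp only: count_below_def diff_self card.empty)
  then have "density p c T e \<le> slab_rate c * (c * ?q + 1) / ?q"
    using count_below_ratio_le_slab[OF p_system_subset[OF assms(1)] assms(3) q, of "c * ?q" e] assms(3) q
    by (simp add: density_def)
  also have "\<dots> \<le> slab_rate c * ((c + 1) * ?q) / ?q"
    using q slab_rate_pos[OF assms(3)] by (intro divide_right_mono mult_left_mono) (auto simp: algebra_simps)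
  finally show ?thesis
    using assms(2) by simp
qed

lemma density_almost_increasing:
  assumes "p_system p T" and "1 < p" and "1 \<le> c"
  shows "\<exists>C. \<forall>e k. density p c T e - C / real p ^ e \<le> density p c T (e + k)"
proof -
  have "0 < p"
    using assms(2) by simp
  then obtain \<beta> where \<beta>: "0 \<le> \<beta>" and tiling: "\<And>e k t.
      count_below (T e) (t - \<beta>) * (p ^ k) ^ d \<le> count_below (T (e + k)) (real p ^ k * t)"
    using ex_tiling_loss assms(1) by blast
  have "density p c T e - slab_rate c * (\<beta> + 1) / real p ^ e \<le> density p c T (e + k)" for e k
  proof -
    let ?q = "real p ^ e"
    have q: "1 \<le> ?q" "0 < real p ^ k"
      using assms(2) by simp_all
    have "real (count_below (T e) (c * ?q - \<beta>)) * (real p ^ k) ^ d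
        \<le> real (count_below (T (e + k)) (c * real p ^ (e + k)))"
      using tiling[of e "c * ?q" k] by (simp add: power_add mult_ac flip: of_nat_power of_nat_mult)
    then have "real (count_below (T e) (c * ?q - \<beta>)) / ?q ^ d \<le> density p c T (e + k)"
      using q assms(2) by (simp add: density_def power_add power_mult_distrib field_simps)
    then show ?thesis
      using count_below_ratio_le_slab[OF p_system_subset[OF assms(1)] assms(3) q(1) \<beta>, of e]
      by (simp add: density_def)
  qed
  then show ?thesis
    by blast
qed

lemma density_convergent:
  assumes "p_system p T" and "1 < p" and "1 \<le> c"
  shows "convergent (density p c T)"
proof -
  obtain C where "\<And>e k. density p c T e - C / real p ^ e \<le> density p c T (e + k)"
    using density_almost_increasing[OF assms] by blast
  then show ?thesis
    by (rule convergent_if_almost_increasing[OF density_le[OF assms] inverse_power_tendsto_0[OF assms(2)]])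
qed

lemma density_lower_bound:
  assumes "1 < p" and "0 < \<delta>"
  shows "\<exists>\<eta>>0. \<forall>\<^sub>F e in sequentially. \<eta> \<le> density p \<delta> (\<lambda>_. S) e"
proof -
  have "0 < p"
    using assms(1) by simp
  then obtain \<beta> where tiling: "\<And>k t.
      count_below S (t - \<beta>) * (p ^ k) ^ d \<le> count_below S (real p ^ k * t)"
    using ex_tiling_loss p_system_const by metis
  obtain j where j: "\<beta> / \<delta> < real p ^ j"
    using real_arch_pow[of "real p"] assms(1) by auto
  have "0 \<in> {u \<in> S. wt u < \<delta> * real p ^ j - \<beta>}"
    using zero_mem j assms(2) by (simp add: field_simps)
  then have "1 \<le> count_below S (\<delta> * real p ^ j - \<beta>)"
    unfolding count_below_def using finite_below[OF subset_refl]
    by (metis One_nat_def Suc_leI card_gt_0_iff empty_iff)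
  then have boxes: "(p ^ k) ^ d \<le> count_below S (real p ^ k * (\<delta> * real p ^ j))" for k
    using tiling[of "\<delta> * real p ^ j" k] by (metis le_trans mult_1 mult_le_mono1)
  have "1 / (real p ^ j) ^ d \<le> density p \<delta> (\<lambda>_. S) e" if "j \<le> e" for e
  proof -
    define k where "k = e - j"
    have "real ((p ^ k) ^ d) \<le> real (count_below S (\<delta> * real p ^ e))"
      using boxes[of k] that unfolding of_nat_le_iff by (simp add: k_def mult_ac flip: power_add)
    moreover have "e = k + j"
      using that by (simp add: k_def)
    ultimately show ?thesis
      using assms(1) by (simp add: density_def power_add power_mult_distrib divide_simps mult_ac)
  qed
  then show ?thesis
    using assms(1) by (intro exI[of _ "1 / (real p ^ j) ^ d"]) (auto simp: eventually_sequentially)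
qed

definition gap :: "nat \<Rightarrow> real \<Rightarrow> (nat \<Rightarrow> (nat \<Rightarrow> int) set) \<Rightarrow> nat \<Rightarrow> real" where
  "gap p c T e = density p c (\<lambda>_. S) e - density p c T e"

lemma gap_convergent: "p_system p T \<Longrightarrow> 1 < p \<Longrightarrow> 1 \<le> c \<Longrightarrow> convergent (gap p c T)"
  unfolding gap_def by (intro convergent_diff density_convergent p_system_const)

lemma density_le_gap:
  assumes T: "p_system p T" and "0 < p" and "\<delta> \<le> c" and deep: "\<And>u. u \<in> T e \<Longrightarrow> \<delta> * real p ^ e \<le> wt u"
  shows "density p \<delta> (\<lambda>_. S) e \<le> gap p c T e"
proof -
  let ?q = "real p ^ e"
  let ?low = "{u \<in> S. wt u < \<delta> * ?q}" and ?T = "{u \<in> T e. wt u < c * ?q}"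
  have "?low \<inter> ?T = {}"
    using deep by force
  then have "card ?low + card ?T = card (?low \<union> ?T)"
    by (intro card_Un_disjoint[symmetric] finite_below p_system_subset[OF T]) simp_all
  also have "\<dots> \<le> count_below S (c * ?q)"
  proof -
    have "\<delta> * ?q \<le> c * ?q"
      using assms(3) by (intro mult_right_mono) auto
    then show ?thesis
      unfolding count_below_def using p_system_subset[OF T, of e] by (intro card_mono finite_below) auto
  qed
  finally have "real (count_below S (\<delta> * ?q)) + real (count_below (T e) (c * ?q))
      \<le> real (count_below S (c * ?q))"
    by (simp add: count_below_def flip: of_nat_add)
  then show ?thesis
    using assms(2) by (simp add: gap_def density_def divide_right_mono flip: diff_divide_distrib)
qed

lemma gap_limit_pos:
  assumes "p_system p T" and "1 < p" and "1 \<le> c" and lim: "gap p c T \<longlonglongrightarrow> l"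
    and "0 < \<delta>" and deep: "\<forall>\<^sub>F e in sequentially. \<forall>u\<in>T e. \<delta> * real p ^ e \<le> wt u"
  shows "0 < l"
proof -
  define \<delta>' where "\<delta>' = min \<delta> c"
  have "0 < \<delta>'"
    using assms(3,5) by (simp add: \<delta>'_def)
  then obtain \<eta> where \<eta>: "0 < \<eta>" "\<forall>\<^sub>F e in sequentially. \<eta> \<le> density p \<delta>' (\<lambda>_. S) e"
    using density_lower_bound[OF assms(2)] by blast
  from \<eta>(2) deep have "\<forall>\<^sub>F e in sequentially. \<eta> \<le> gap p c T e"
  proof eventually_elim
    case (elim e)
    have "\<delta>' * real p ^ e \<le> \<delta> * real p ^ e"
      unfolding \<delta>'_def by (intro mult_right_mono) auto
    then have "\<delta>' * real p ^ e \<le> wt u" if "u \<in> T e" for u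
      using elim(2) that by fastforce
    then have "density p \<delta>' (\<lambda>_. S) e \<le> gap p c T e"
      using assms(2) by (intro density_le_gap[OF assms(1)]) (auto simp: \<delta>'_def)
    with elim(1) show ?case
      by linarith
  qed
  then have "\<eta> \<le> l"
    by (intro tendsto_lowerbound[OF lim]) simp_all
  then show ?thesis
    using \<eta>(1) by simp
qed

lemma gap_limit_le:
  assumes T: "p_system p T" and p: "1 < p" and c: "1 \<le> c" and lim: "gap p c T \<longlonglongrightarrow> l" and w: "w \<in> T e"
  shows "l \<le> slab_rate c * wt w / real p ^ e"
proof -
  have "gap p c T (k + e) \<le> slab_rate c * wt w / real p ^ e + slab_rate c / real p ^ (k + e)" for k
  proof -
    let ?q = "real p ^ (k + e)" and ?v = "of_nat (p ^ k) * w"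
    have q: "1 \<le> ?q"
      using p by simp
    have v: "?v \<in> T (k + e)"
      using p_system_power_mult[OF T w, of k] by (simp add: add.commute)
    then have "0 \<le> wt ?v"
      using p_system_subset[OF T] wt_nonneg by blast
    have "(+) ?v ` S \<subseteq> T (k + e)"
      using p_system_add[OF T v] by blast
    then have "count_below ((+) ?v ` S) (c * ?q) \<le> count_below (T (k + e)) (c * ?q)"
      by (intro count_below_mono p_system_subset[OF T]) simp_all
    then have "real (count_below S (c * ?q - wt ?v)) / ?q ^ d \<le> density p c T (k + e)"
      unfolding count_below_translate density_def by (intro divide_right_mono) auto
    then have "gap p c T (k + e) \<le> slab_rate c * (wt ?v + 1) / ?q"
      using count_below_ratio_le_slab[OF subset_refl c q \<open>0 \<le> wt ?v\<close>]
      by (simp add: gap_def density_def)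
    also have "\<dots> = slab_rate c * wt w / real p ^ e + slab_rate c / ?q"
      unfolding pair_a_of_nat_mult using p by (simp add: power_add field_simps)
    finally show ?thesis .
  qed
  moreover have "(\<lambda>k. gap p c T (k + e)) \<longlonglongrightarrow> l"
    using lim by (rule LIMSEQ_ignore_initial_segment)
  moreover have "(\<lambda>k. slab_rate c * wt w / real p ^ e + slab_rate c / real p ^ (k + e))
      \<longlonglongrightarrow> slab_rate c * wt w / real p ^ e + 0"
    by (intro tendsto_add tendsto_const LIMSEQ_ignore_initial_segment inverse_power_tendsto_0 p)
  ultimately show ?thesis
    using LIMSEQ_le by fastforce
qed

lemma gap_limit_nonpos:
  assumes "p_system p T" and "1 < p" and "1 \<le> c" and "gap p c T \<longlonglongrightarrow> l"
    and shallow: "\<And>j. \<exists>e. \<exists>w\<in>T (e + j). wt w < \<kappa> * real p ^ e"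
  shows "l \<le> 0"
proof -
  have "l \<le> slab_rate c * \<kappa> / real p ^ j" for j
  proof -
    obtain e w where w: "w \<in> T (e + j)" "wt w < \<kappa> * real p ^ e"
      using shallow by blast
    have "l \<le> slab_rate c * wt w / real p ^ (e + j)"
      by (rule gap_limit_le[OF assms(1-4) w(1)])
    also have "\<dots> \<le> slab_rate c * (\<kappa> * real p ^ e) / real p ^ (e + j)"
      using w(2) slab_rate_pos[OF assms(3)] by (intro divide_right_mono mult_left_mono) auto
    also have "\<dots> = slab_rate c * \<kappa> / real p ^ j"
      using assms(2) by (simp add: power_add)
    finally show ?thesis .
  qed
  then show ?thesis
    by (intro LIMSEQ_le_const[OF inverse_power_tendsto_0[OF assms(2)]]) blast
qed

end

section \<open>Ideals\<close>

interpretation ideal: module "(*) :: 'a::comm_ring_1 \<Rightarrow> 'a \<Rightarrow> 'a"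
  by standard (simp_all add: algebra_simps)

declare ideal.scale_scale [simp del] \<comment> \<open>it loops with \<open>mult.assoc\<close>\<close>

lemma is_ideal_iff_subspace: "is_ideal I \<longleftrightarrow> ideal.subspace I"
  by (auto simp: is_ideal_def ideal.subspace_def)

lemma ideal_gen_eq_span: "ideal_gen S = ideal.span S"
  by (auto simp: ideal_gen_def ideal.span_explicit)

lemma is_ideal_ideal_gen [simp]: "is_ideal (ideal_gen S)"
  by (simp add: is_ideal_iff_subspace ideal_gen_eq_span)

lemma ideal_gen_base: "x \<in> S \<Longrightarrow> x \<in> ideal_gen S"
  by (simp add: ideal_gen_eq_span ideal.span_base)

lemma ideal_gen_least: "is_ideal J \<Longrightarrow> S \<subseteq> J \<Longrightarrow> ideal_gen S \<subseteq> J"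
  by (simp add: is_ideal_iff_subspace ideal_gen_eq_span ideal.span_minimal)

lemma
  assumes "is_ideal I"
  shows is_ideal_zero: "0 \<in> I"
    and is_ideal_add: "x \<in> I \<Longrightarrow> y \<in> I \<Longrightarrow> x + y \<in> I"
    and is_ideal_diff: "x \<in> I \<Longrightarrow> y \<in> I \<Longrightarrow> x - y \<in> I"
    and is_ideal_mult: "x \<in> I \<Longrightarrow> r * x \<in> I"
    and is_ideal_sum: "(\<And>i. i \<in> A \<Longrightarrow> f i \<in> I) \<Longrightarrow> sum f A \<in> I"
  using assms unfolding is_ideal_iff_subspace
  by (simp_all add: ideal.subspace_0 ideal.subspace_add ideal.subspace_diff ideal.subspace_scale
      ideal.subspace_sum)

lemma is_ideal_UNIV [simp]: "is_ideal UNIV"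
  by (simp add: is_ideal_def)

lemma is_ideal_dvd: "is_ideal I \<Longrightarrow> x \<in> I \<Longrightarrow> x dvd y \<Longrightarrow> y \<in> I"
  by (auto simp: dvd_def mult.commute[of x] intro: is_ideal_mult)

lemma is_ideal_eq_UNIV_iff: "is_ideal I \<Longrightarrow> I = UNIV \<longleftrightarrow> 1 \<in> I"
  using is_ideal_dvd[of I 1] by auto

lemma mem_ideal_gen_insert:
  assumes "is_ideal I"
  shows "y \<in> ideal_gen (insert x I) \<longleftrightarrow> (\<exists>r. y - r * x \<in> I)"
proof -
  have "ideal.span I = I"
    using assms by (simp add: is_ideal_iff_subspace)
  then show ?thesis
    by (simp only: ideal_gen_eq_span ideal.span_breakdown_eq)
qed

lemma is_ideal_Union_chain:
  assumes "C \<noteq> {}" and "subset.chain {J. is_ideal J} C"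
  shows "is_ideal (\<Union>C)"
  unfolding is_ideal_def
proof (intro conjI ballI allI)
  have ideals: "\<And>J. J \<in> C \<Longrightarrow> is_ideal J" and chain: "\<And>J K. J \<in> C \<Longrightarrow> K \<in> C \<Longrightarrow> J \<subseteq> K \<or> K \<subseteq> J"
    using assms(2) unfolding subset_chain_def by blast+
  show "0 \<in> \<Union>C"
    using assms(1) ideals is_ideal_zero by blast
  show "r * x \<in> \<Union>C" if "x \<in> \<Union>C" for r x
    using that ideals is_ideal_mult by blast
  show "x + y \<in> \<Union>C" if xy: "x \<in> \<Union>C" "y \<in> \<Union>C" for x y
  proof -
    obtain J K where "J \<in> C" "x \<in> J" "K \<in> C" "y \<in> K"
      using xy by blast
    then obtain L where "L \<in> C" "x \<in> L" "y \<in> L"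
      using chain[of J K] by blast
    then show ?thesis
      using is_ideal_add[OF ideals] by blast
  qed
qed

lemma ex_maximal_ideal_superset:
  assumes "is_ideal I" and "I \<noteq> UNIV"
  shows "\<exists>M. maximal_ideal M \<and> I \<subseteq> M"
proof -
  let ?A = "{J. is_ideal J \<and> I \<subseteq> J \<and> 1 \<notin> J}"
  have "\<Union>C \<in> ?A" if "C \<noteq> {}" "subset.chain ?A C" for C
  proof -
    have "C \<subseteq> ?A" "subset.chain {J. is_ideal J} C"
      using that(2) unfolding subset_chain_def by blast+
    then show ?thesis
      using is_ideal_Union_chain[OF that(1)] that(1) by blast
  qed
  moreover have "?A \<noteq> {}"
    using assms is_ideal_eq_UNIV_iff by blast
  ultimately have "\<exists>M\<in>?A. \<forall>J\<in>?A. M \<subseteq> J \<longrightarrow> J = M"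
    by (intro subset_Zorn_nonempty)
  then obtain M where M: "M \<in> ?A" "\<forall>J\<in>?A. M \<subseteq> J \<longrightarrow> J = M"
    by (rule bexE)
  then have "J = M \<or> J = UNIV" if "is_ideal J" "M \<subseteq> J" for J
    using that is_ideal_eq_UNIV_iff[OF that(1)] by blast
  then have "maximal_ideal M"
    using M(1) unfolding maximal_ideal_def by blast
  then show ?thesis
    using M(1) by blast
qed

lemma local_ring_is_ideal: "local_ring_with_max m \<Longrightarrow> is_ideal m"
  by (simp add: local_ring_with_max_def maximal_ideal_def)

lemma local_ring_dvd_one:
  assumes "local_ring_with_max m" and "x \<notin> m"
  shows "x dvd 1"
proof (rule ccontr)
  assume "\<not> x dvd 1"
  then have "1 \<notin> ideal_gen {x}"
    by (auto simp: ideal_gen_eq_span ideal.span_singleton dvd_def mult.commute)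
  then obtain M where "maximal_ideal M" "ideal_gen {x} \<subseteq> M"
    using ex_maximal_ideal_superset[of "ideal_gen {x}"] by auto
  then show False
    using assms ideal_gen_base[of x "{x}"] unfolding local_ring_with_max_def by blast
qed

lemma local_ring_finitely_generated:
  fixes m I :: "'a::comm_ring_1 set"
  assumes "local_ring_with_max m" and "is_ideal I"
  shows "\<exists>F. finite F \<and> I = ideal_gen F"
  using assms by (simp add: local_ring_with_max_def noetherian_ring_def)

lemma is_ideal_colon: "is_ideal K \<Longrightarrow> is_ideal {x. x * y \<in> K}"
  unfolding is_ideal_def by (auto simp: distrib_right mult.assoc)

lemma ideal_pow_Suc_subset:
  assumes "is_ideal I"
  shows "ideal_pow I (Suc n) \<subseteq> I"
  unfolding ideal_pow.simps ideal_prod_def using assms is_ideal_mult[OF assms]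
  by (intro ideal_gen_least) (auto simp: mult.commute)

lemma ideal_prod_gen_subset: "ideal_prod (ideal_gen A) (ideal_gen B) \<subseteq> ideal_gen {x * y |x y. x \<in> A \<and> y \<in> B}"
proof -
  let ?P = "ideal_gen {x * y |x y. x \<in> A \<and> y \<in> B}"
  have colon: "is_ideal {x. x * y \<in> ?P}" for y
    by (rule is_ideal_colon[OF is_ideal_ideal_gen])
  have "ideal_gen B \<subseteq> {y. y * x \<in> ?P}" if "x \<in> A" for x
    using that by (intro ideal_gen_least colon) (auto simp: mult.commute[of _ x] intro!: ideal_gen_base)
  then have "ideal_gen A \<subseteq> {x. x * y \<in> ?P}" if "y \<in> ideal_gen B" for y
    using that by (intro ideal_gen_least colon) (auto simp: mult.commute)
  then show ?thesis
    unfolding ideal_prod_def by (intro ideal_gen_least is_ideal_ideal_gen) blast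
qed

lemma ideal_pow_gen_subset_prod_list:
  "ideal_pow (ideal_gen F) n \<subseteq> ideal_gen {prod_list xs |xs. set xs \<subseteq> F \<and> length xs = n}"
proof (induction n)
  case 0
  have "1 \<in> ideal_gen {prod_list xs |xs. set xs \<subseteq> F \<and> length xs = 0}"
    by (intro ideal_gen_base) auto
  then show ?case
    using is_ideal_eq_UNIV_iff[OF is_ideal_ideal_gen] by auto
next
  case (Suc n)
  let ?M = "\<lambda>n. {prod_list xs |xs. set xs \<subseteq> F \<and> length xs = n}"
  have "ideal_pow (ideal_gen F) (Suc n) \<subseteq> ideal_prod (ideal_gen F) (ideal_gen (?M n))"
    unfolding ideal_pow.simps ideal_prod_def
    using Suc by (intro ideal_gen_least is_ideal_ideal_gen) (blast intro: ideal_gen_base)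
  also have "\<dots> \<subseteq> ideal_gen {x * y |x y. x \<in> F \<and> y \<in> ?M n}"
    by (rule ideal_prod_gen_subset)
  also have "{x * y |x y. x \<in> F \<and> y \<in> ?M n} \<subseteq> ?M (Suc n)"
  proof clarify
    fix x xs
    assume "x \<in> F" "set xs \<subseteq> F"
    then show "\<exists>ys. x * prod_list xs = prod_list ys \<and> set ys \<subseteq> F \<and> length ys = Suc (length xs)"
      by (intro exI[of _ "x # xs"]) simp
  qed
  then have "ideal_gen {x * y |x y. x \<in> F \<and> y \<in> ?M n} \<subseteq> ideal_gen (?M (Suc n))"
    by (intro ideal_gen_least is_ideal_ideal_gen) (blast intro: ideal_gen_base)
  finally show ?case .
qed

lemma power_count_list_dvd_prod_list: "x ^ count_list xs x dvd prod_list (xs :: 'a::comm_semiring_1 list)"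
  by (induction xs) (auto intro: mult_dvd_mono)

text \<open>Pigeonhole: a product of more than \<open>N |F|\<close> generators contains some generator \<open>N\<close> times.\<close>

lemma ideal_pow_gen_subset:
  assumes "finite F" and "is_ideal K" and "\<And>g. g \<in> F \<Longrightarrow> g ^ N \<in> K"
  shows "ideal_pow (ideal_gen F) (card F * N + 1) \<subseteq> K"
proof -
  have "prod_list xs \<in> K" if xs: "set xs \<subseteq> F" "length xs = card F * N + 1" for xs
  proof -
    obtain g where g: "g \<in> F" "N \<le> count_list xs g"
    proof (rule ccontr)
      assume "\<not> thesis"
      then have "(\<Sum>g\<in>F. count_list xs g) \<le> (\<Sum>g\<in>F. N)"
        using that by (intro sum_mono) (meson nat_le_linear)
      then show False
        using xs assms(1) by (simp add: sum_count_set)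
    qed
    then have "g ^ N dvd prod_list xs"
      using power_count_list_dvd_prod_list le_imp_power_dvd dvd_trans by blast
    then show ?thesis
      using is_ideal_dvd[OF assms(2) assms(3)[OF g(1)]] by blast
  qed
  then have "ideal_gen {prod_list xs |xs. set xs \<subseteq> F \<and> length xs = card F * N + 1} \<subseteq> K"
    by (intro ideal_gen_least assms(2)) auto
  then show ?thesis
    using ideal_pow_gen_subset_prod_list by blast
qed

lemma power_mem_ideal_pow: "x \<in> I \<Longrightarrow> x ^ n \<in> ideal_pow I n"
  by (induction n) (auto simp: ideal_prod_def intro!: ideal_gen_base)

lemma ex_common_exponent:
  assumes "finite F" and "is_ideal K" and "ideal_gen F \<subseteq> radical K"
  shows "\<exists>N. \<forall>x\<in>ideal_gen F. x ^ N \<in> K"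
proof -
  have "\<forall>g\<in>F. \<exists>n. g ^ n \<in> K"
    using assms(3) ideal_gen_base unfolding radical_def by blast
  then obtain h where h: "\<And>g. g \<in> F \<Longrightarrow> g ^ h g \<in> K"
    by metis
  have "g ^ sum h F \<in> K" if "g \<in> F" for g
    using is_ideal_dvd[OF assms(2) h[OF that]] le_imp_power_dvd member_le_sum[of g F h] that assms(1) by blast
  then have "ideal_pow (ideal_gen F) (card F * sum h F + 1) \<subseteq> K"
    by (rule ideal_pow_gen_subset[OF assms(1,2)])
  then show ?thesis
    using power_mem_ideal_pow by blast
qed

lemma is_ideal_frob_pow [simp]: "is_ideal (frob_pow q I)"
  by (simp add: frob_pow_def)

lemma power_mem_frob_pow: "x \<in> I \<Longrightarrow> x ^ q \<in> frob_pow q I"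
  unfolding frob_pow_def by (auto intro: ideal_gen_base)

lemma frob_pow_least: "is_ideal J \<Longrightarrow> (\<And>x. x \<in> I \<Longrightarrow> x ^ q \<in> J) \<Longrightarrow> frob_pow q I \<subseteq> J"
  unfolding frob_pow_def by (intro ideal_gen_least) auto

lemma p_family_is_ideal: "p_family p I \<Longrightarrow> is_ideal (I e)"
  by (simp add: p_family_def)

lemma p_family_power:
  assumes "p_family p I" and "x \<in> I e"
  shows "x ^ (p ^ k) \<in> I (e + k)"
proof (induction k)
  case (Suc k)
  then have "(x ^ (p ^ k)) ^ p \<in> I (Suc (e + k))"
    using assms(1) power_mem_frob_pow unfolding p_family_def by blast
  then show ?case
    by (simp add: mult.commute flip: power_mult)
qed (use assms in simp)

lemma sum_eliminate:
  fixes f g k :: "'b \<Rightarrow> 'a::comm_ring_1"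
  assumes "finite X" and "x0 \<in> X"
  shows "(\<Sum>x\<in>X. ((\<lambda>x. k x * f x0)(x0 := - (\<Sum>x\<in>X - {x0}. k x * f x))) x * g x)
    = (\<Sum>x\<in>X - {x0}. k x * (f x0 * g x - f x * g x0))"
proof -
  let ?k = "(\<lambda>x. k x * f x0)(x0 := - (\<Sum>x\<in>X - {x0}. k x * f x))"
  have "(\<Sum>x\<in>X. ?k x * g x) = ?k x0 * g x0 + (\<Sum>x\<in>X - {x0}. ?k x * g x)"
    using assms by (rule sum.remove)
  also have "(\<Sum>x\<in>X - {x0}. ?k x * g x) = (\<Sum>x\<in>X - {x0}. k x * f x0 * g x)"
    by (rule sum.cong) auto
  also have "?k x0 * g x0 = - (\<Sum>x\<in>X - {x0}. k x * f x * g x0)"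
    by (simp add: sum_distrib_right)
  finally show ?thesis
    by (simp add: sum_subtractf algebra_simps)
qed

lemma relation_mod_prime_insert:
  assumes "prime_ideal P" and "finite X" and x0: "x0 \<in> X" "c x0 b0 \<notin> P"
    and k: "\<exists>x\<in>X - {x0}. k x \<notin> P"
      "\<And>b. b \<in> B \<Longrightarrow> (\<Sum>x\<in>X - {x0}. k x * (c x0 b0 * c x b - c x b0 * c x0 b)) \<in> P"
  shows "\<exists>k. (\<exists>x\<in>X. k x \<notin> P) \<and> (\<forall>b\<in>insert b0 B. (\<Sum>x\<in>X. k x * c x b) \<in> P)"
proof -
  have P: "is_ideal P" and prime: "\<And>x y. x * y \<in> P \<Longrightarrow> x \<in> P \<or> y \<in> P"
    using assms(1) unfolding prime_ideal_def by auto
  define k' where "k' = (\<lambda>x. k x * c x0 b0)(x0 := - (\<Sum>x\<in>X - {x0}. k x * c x b0))"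
  have relation: "(\<Sum>x\<in>X. k' x * c x b) = (\<Sum>x\<in>X - {x0}. k x * (c x0 b0 * c x b - c x b0 * c x0 b))" for b
    unfolding k'_def by (rule sum_eliminate[OF assms(2) x0(1)])
  then have "(\<Sum>x\<in>X. k' x * c x b0) = 0"
    by (simp add: mult.commute)
  then have "\<forall>b\<in>insert b0 B. (\<Sum>x\<in>X. k' x * c x b) \<in> P"
    using k(2) is_ideal_zero[OF P] relation by auto
  moreover obtain y where y: "y \<in> X" "y \<noteq> x0" "k y \<notin> P"
    using k(1) by blast
  then have "k' y \<notin> P"
    using prime x0(2) by (auto simp: k'_def)
  ultimately show ?thesis
    using y(1) by blast
qed

text \<open>Gaussian elimination over the residue field, with denominators cleared.\<close>

lemma nontrivial_relation_mod_prime: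
  assumes "prime_ideal P" and "finite B" and "finite X" and "card B < card X"
  shows "\<exists>k. (\<exists>x\<in>X. k x \<notin> P) \<and> (\<forall>b\<in>B. (\<Sum>x\<in>X. k x * c x b) \<in> P)"
  using assms(2-4)
proof (induction B arbitrary: X c rule: finite_induct)
  case empty
  have "1 \<notin> P"
    using assms(1) is_ideal_eq_UNIV_iff unfolding prime_ideal_def by blast
  moreover have "X \<noteq> {}"
    using empty by auto
  ultimately show ?case
    by (intro exI[of _ "\<lambda>_. 1"]) auto
next
  case (insert b0 B)
  show ?case
  proof (cases "\<forall>x\<in>X. c x b0 \<in> P")
    case True
    have P: "is_ideal P"
      using assms(1) unfolding prime_ideal_def by blast
    have "(\<Sum>x\<in>X. k x * c x b0) \<in> P" for k
      using True by (intro is_ideal_sum[OF P] is_ideal_mult[OF P]) blast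
    then show ?thesis
      using insert.IH[OF insert.prems(1), of c] insert.prems(2) insert.hyps by fastforce
  next
    case False
    then obtain x0 where x0: "x0 \<in> X" "c x0 b0 \<notin> P"
      by blast
    have "finite (X - {x0})" "card B < card (X - {x0})"
      using insert x0 by auto
    then obtain k where "\<exists>x\<in>X - {x0}. k x \<notin> P"
      "\<And>b. b \<in> B \<Longrightarrow> (\<Sum>x\<in>X - {x0}. k x * (c x0 b0 * c x b - c x b0 * c x0 b)) \<in> P"
      using insert.IH[of "X - {x0}" "\<lambda>x b. c x0 b0 * c x b - c x b0 * c x0 b"] by blast
    then show ?thesis
      by (rule relation_mod_prime_insert[where c = c, OF assms(1) insert.prems(1) x0])
  qed
qed

section \<open>Colength\<close>

lemma ideal_chain_from_0 [simp]: "ideal_chain_from J 0 \<longleftrightarrow> J = UNIV"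
  by (auto simp: ideal_chain_from_def)

lemma ideal_chain_from_Suc:
  "ideal_chain_from J (Suc n) \<longleftrightarrow> is_ideal J \<and> (\<exists>K. J \<subset> K \<and> ideal_chain_from K n)"
proof
  assume "ideal_chain_from J (Suc n)"
  then obtain C where C: "C 0 = J" "C (Suc n) = UNIV" "\<And>i. i \<le> Suc n \<Longrightarrow> is_ideal (C i)"
    "\<And>i. i < Suc n \<Longrightarrow> C i \<subset> C (Suc i)"
    unfolding ideal_chain_from_def by blast
  then have "ideal_chain_from (C 1) n"
    unfolding ideal_chain_from_def by (intro exI[of _ "\<lambda>i. C (Suc i)"]) simp
  then show "is_ideal J \<and> (\<exists>K. J \<subset> K \<and> ideal_chain_from K n)"
    using C(3,4)[of 0] C(1) by auto
next
  assume "is_ideal J \<and> (\<exists>K. J \<subset> K \<and> ideal_chain_from K n)"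
  then obtain K C where J: "is_ideal J" "J \<subset> K" and C: "C 0 = K" "C n = UNIV" "\<forall>i\<le>n. is_ideal (C i)"
    "\<forall>i<n. C i \<subset> C (Suc i)"
    unfolding ideal_chain_from_def by blast
  define D where "D i = (case i of 0 \<Rightarrow> J | Suc i \<Rightarrow> C i)" for i
  have "D 0 = J" "D (Suc n) = UNIV" "\<forall>i\<le>Suc n. is_ideal (D i)" "\<forall>i<Suc n. D i \<subset> D (Suc i)"
    using J C by (auto simp: D_def less_Suc_eq_0_disj split: nat.split)
  then show "ideal_chain_from J (Suc n)"
    unfolding ideal_chain_from_def by blast
qed

lemma ideal_chain_from_is_ideal: "ideal_chain_from J n \<Longrightarrow> is_ideal J"
  by (cases n) (simp_all add: ideal_chain_from_Suc)

lemma ideal_chain_from_length_le: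
  fixes \<phi> :: "'a::comm_ring_1 set \<Rightarrow> nat"
  assumes strict: "\<And>K K'. is_ideal K \<Longrightarrow> is_ideal K' \<Longrightarrow> J \<subseteq> K \<Longrightarrow> K \<subset> K' \<Longrightarrow> \<phi> K' < \<phi> K"
    and "ideal_chain_from K n" and "J \<subseteq> K"
  shows "n \<le> \<phi> K"
  using assms(2,3)
proof (induction n arbitrary: K)
  case (Suc n)
  then obtain K' where K': "is_ideal K" "K \<subset> K'" "ideal_chain_from K' n"
    by (auto simp: ideal_chain_from_Suc)
  then have "n \<le> \<phi> K'" "\<phi> K' < \<phi> K"
    using Suc strict[OF K'(1) ideal_chain_from_is_ideal[OF K'(3)]] by auto
  then show ?case
    by simp
qed simp

lemma colength_eqI:
  fixes \<phi> :: "'a::comm_ring_1 set \<Rightarrow> nat"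
  assumes J: "is_ideal J" and UNIV: "\<phi> UNIV = 0"
    and strict: "\<And>K K'. is_ideal K \<Longrightarrow> is_ideal K' \<Longrightarrow> J \<subseteq> K \<Longrightarrow> K \<subset> K' \<Longrightarrow> \<phi> K' < \<phi> K"
    and step: "\<And>K. is_ideal K \<Longrightarrow> J \<subseteq> K \<Longrightarrow> K \<noteq> UNIV \<Longrightarrow> \<exists>K'. is_ideal K' \<and> K \<subset> K' \<and> \<phi> K \<le> Suc (\<phi> K')"
  shows "colength J = \<phi> J"
proof -
  have "ideal_chain_from K (\<phi> K)" if "is_ideal K" "J \<subseteq> K" for K
    using that
  proof (induction "\<phi> K" arbitrary: K rule: less_induct)
    case less
    show ?case
    proof (cases "K = UNIV")
      case False
      then obtain K' where K': "is_ideal K'" "K \<subset> K'" "\<phi> K \<le> Suc (\<phi> K')"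
        using step less.prems by blast
      have "\<phi> K' < \<phi> K"
        by (rule strict[OF less.prems(1) K'(1) less.prems(2) K'(2)])
      then have "ideal_chain_from K' (\<phi> K')" "\<phi> K = Suc (\<phi> K')"
        using less K' by auto
      then show ?thesis
        using less.prems(1) K'(2) by (auto simp: ideal_chain_from_Suc)
    qed (simp add: UNIV)
  qed
  then have "ideal_chain_from J (\<phi> J)"
    using J by simp
  then show ?thesis
    unfolding colength_def
    by (intro cSup_eq_maximum) (auto intro: ideal_chain_from_length_le[OF strict])
qed

section \<open>Valued local rings\<close>

lemma to_fract_sum: "to_fract (\<Sum>i\<in>A. f i) = (\<Sum>i\<in>A. to_fract (f i))"
  by (induction A rule: infinite_finite_induct) simp_all

lemma to_fract_power: "to_fract (x ^ n) = to_fract x ^ n"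
  by (induction n) simp_all

lemma ex_denominator: "\<exists>b g. b \<noteq> 0 \<and> x * to_fract b = to_fract g"
proof (cases x)
  case (Fract g b)
  then have "x * to_fract b = to_fract g"
    by (simp add: Fract_conv_to_fract)
  with Fract(2) show ?thesis
    by blast
qed

lemma ex_common_denominator:
  assumes "finite A"
  shows "\<exists>b. b \<noteq> 0 \<and> (\<forall>x\<in>A. \<exists>g. x * to_fract b = to_fract g)"
  using assms
proof (induction A rule: finite_induct)
  case empty
  show ?case
    by (intro exI[of _ 1]) simp
next
  case (insert x A)
  obtain b where b: "b \<noteq> 0" "\<And>y. y \<in> A \<Longrightarrow> \<exists>g. y * to_fract b = to_fract g"
    using insert.IH by blast
  obtain b' g' where b': "b' \<noteq> 0" "x * to_fract b' = to_fract g'"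
    using ex_denominator by blast
  have "\<exists>g. y * to_fract (b * b') = to_fract g" if y: "y \<in> insert x A" for y
  proof (cases "y = x")
    case True
    then have "y * to_fract (b * b') = to_fract (g' * b)"
      using b'(2) by (simp add: mult.left_commute mult.commute)
    then show ?thesis ..
  next
    case False
    then obtain g where "y * to_fract b = to_fract g"
      using b(2) y by blast
    then have "y * to_fract (b * b') = to_fract (g * b')"
      by (simp add: mult.assoc[symmetric])
    then show ?thesis ..
  qed
  then show ?case
    using b(1) b'(1) by (intro exI[of _ "b * b'"]) simp
qed

locale real_valuation =
  fixes W :: "'k::field \<Rightarrow> real"
  assumes W_mult: "x \<noteq> 0 \<Longrightarrow> y \<noteq> 0 \<Longrightarrow> W (x * y) = W x + W y"
    and W_add: "x \<noteq> 0 \<Longrightarrow> y \<noteq> 0 \<Longrightarrow> x + y \<noteq> 0 \<Longrightarrow> min (W x) (W y) \<le> W (x + y)"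
begin

definition F_ge :: "real \<Rightarrow> 'k set" where
  "F_ge t = {x. x \<noteq> 0 \<longrightarrow> t \<le> W x}"

definition F_gt :: "real \<Rightarrow> 'k set" where
  "F_gt t = {x. x \<noteq> 0 \<longrightarrow> t < W x}"

lemma W_one [simp]: "W 1 = 0"
  using W_mult[of 1 1] by simp

lemma W_uminus [simp]: "W (- x) = W x"
proof (cases "x = 0")
  case False
  have "W (-1) + W (-1) = 0"
    using W_mult[of "-1" "-1"] by simp
  then show ?thesis
    using W_mult[of "-1" x] False by simp
qed simp

lemma W_inverse: "x \<noteq> 0 \<Longrightarrow> W (inverse x) = - W x"
  using W_mult[of x "inverse x"] by simp

lemma W_power: "x \<noteq> 0 \<Longrightarrow> W (x ^ n) = real n * W x"
  by (induction n) (simp_all add: W_mult distrib_right)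

lemma zero_mem_F [simp]: "0 \<in> F_ge t" "0 \<in> F_gt t"
  by (simp_all add: F_ge_def F_gt_def)

lemma F_ge_add: "x \<in> F_ge t \<Longrightarrow> y \<in> F_ge t \<Longrightarrow> x + y \<in> F_ge t"
  using W_add[of x y] by (cases "x = 0 \<or> y = 0 \<or> x + y = 0") (auto simp: F_ge_def)

lemma F_gt_add: "x \<in> F_gt t \<Longrightarrow> y \<in> F_gt t \<Longrightarrow> x + y \<in> F_gt t"
  using W_add[of x y] by (cases "x = 0 \<or> y = 0 \<or> x + y = 0") (auto simp: F_gt_def)

lemma F_ge_diff: "x \<in> F_ge t \<Longrightarrow> y \<in> F_ge t \<Longrightarrow> x - y \<in> F_ge t"
  using F_ge_add[of x t "- y"] by (simp add: F_ge_def)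

lemma F_gt_diff: "x \<in> F_gt t \<Longrightarrow> y \<in> F_gt t \<Longrightarrow> x - y \<in> F_gt t"
  using F_gt_add[of x t "- y"] by (simp add: F_gt_def)

lemma F_ge_antimono: "s \<le> t \<Longrightarrow> F_ge t \<subseteq> F_ge s"
  by (auto simp: F_ge_def)

lemma F_gt_sum: "(\<And>i. i \<in> A \<Longrightarrow> f i \<in> F_gt t) \<Longrightarrow> (\<Sum>i\<in>A. f i) \<in> F_gt t"
  by (induction A rule: infinite_finite_induct) (auto intro: F_gt_add)

lemma F_ge_0_mult_F_ge: "x \<in> F_ge 0 \<Longrightarrow> y \<in> F_ge t \<Longrightarrow> x * y \<in> F_ge t"
  using W_mult[of x y] by (auto simp: F_ge_def)

lemma F_ge_0_mult_F_gt: "x \<in> F_ge 0 \<Longrightarrow> y \<in> F_gt t \<Longrightarrow> x * y \<in> F_gt t"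
  using W_mult[of x y] by (auto simp: F_ge_def F_gt_def)

lemma F_gt_0_mult_F_ge: "x \<in> F_gt 0 \<Longrightarrow> y \<in> F_ge t \<Longrightarrow> x * y \<in> F_gt t"
  using W_mult[of x y] by (auto simp: F_ge_def F_gt_def)

lemma
  assumes "z \<noteq> 0"
  shows mult_right_mem_F_ge_iff: "x * z \<in> F_ge (t + W z) \<longleftrightarrow> x \<in> F_ge t"
    and mult_right_mem_F_gt_iff: "x * z \<in> F_gt (t + W z) \<longleftrightarrow> x \<in> F_gt t"
  using assms W_mult[of x z] by (auto simp: F_ge_def F_gt_def)

end

locale valued_local_ring = real_valuation W
  for W :: "'a::idom fract \<Rightarrow> real" +
  fixes m :: "'a set"
  assumes local_ring: "local_ring_with_max m"
    and to_fract_mem_F_ge: "to_fract x \<in> F_ge 0"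
    and mem_max_iff: "x \<in> m \<longleftrightarrow> to_fract x \<in> F_gt 0"
    and residue_finite: "\<exists>B. finite B \<and> B \<subseteq> F_ge 0 \<and>
      (\<forall>y\<in>F_ge 0. \<exists>c. y - (\<Sum>b\<in>B. to_fract (c b) * b) \<in> F_gt 0)"
begin

lemma is_ideal_max: "is_ideal m"
  by (rule local_ring_is_ideal[OF local_ring])

lemma W_to_fract_nonneg: "x \<noteq> 0 \<Longrightarrow> 0 \<le> W (to_fract x)"
  using to_fract_mem_F_ge[of x] by (simp add: F_ge_def)

lemma to_fract_mult_F_ge: "x \<in> F_ge t \<Longrightarrow> to_fract r * x \<in> F_ge t"
  by (rule F_ge_0_mult_F_ge[OF to_fract_mem_F_ge])

lemma to_fract_mult_F_gt: "x \<in> F_gt t \<Longrightarrow> to_fract r * x \<in> F_gt t"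
  by (rule F_ge_0_mult_F_gt[OF to_fract_mem_F_ge])

lemma max_mult_F_ge: "r \<in> m \<Longrightarrow> x \<in> F_ge t \<Longrightarrow> to_fract r * x \<in> F_gt t"
  by (simp add: mem_max_iff F_gt_0_mult_F_ge)

lemma one_not_mem_max: "1 \<notin> m"
  by (simp add: mem_max_iff F_gt_def)

lemma prime_ideal_max: "prime_ideal m"
  unfolding prime_ideal_def
proof (intro conjI allI impI is_ideal_max)
  show "m \<noteq> UNIV"
    using one_not_mem_max by blast
  show "x \<in> m \<or> y \<in> m" if "x * y \<in> m" for x y
    using that W_mult[of "to_fract x" "to_fract y"] W_to_fract_nonneg[of x] W_to_fract_nonneg[of y]
    by (auto simp: mem_max_iff F_gt_def)
qed

subsection \<open>Rank of a graded piece\<close>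

text \<open>The following notions are linear algebra over the residue field \<open>R/m\<close> in the vector space
  \<open>F\<^bsub>\<ge>t\<^esub> / F\<^bsub>>t\<^esub>\<close>, expressed through representatives.\<close>

definition lin_comb :: "('a fract \<Rightarrow> 'a) \<Rightarrow> 'a fract set \<Rightarrow> 'a fract" where
  "lin_comb c B = (\<Sum>b\<in>B. to_fract (c b) * b)"

definition spans :: "real \<Rightarrow> 'a fract set \<Rightarrow> 'a fract \<Rightarrow> bool" where
  "spans t B y \<longleftrightarrow> (\<exists>c. y - lin_comb c B \<in> F_gt t)"

definition indep :: "real \<Rightarrow> 'a fract set \<Rightarrow> bool" where
  "indep t B \<longleftrightarrow> finite B \<and> B \<subseteq> F_ge t \<and> (\<forall>c. lin_comb c B \<in> F_gt t \<longrightarrow> (\<forall>b\<in>B. c b \<in> m))"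

definition rank :: "real \<Rightarrow> 'a fract set \<Rightarrow> nat" where
  "rank t X = Max (card ` {B. B \<subseteq> X \<and> indep t B})"

definition residue_degree :: nat where
  "residue_degree = rank 0 UNIV"

lemma indepD:
  assumes "indep t B"
  shows indep_finite: "finite B"
    and indep_subset_F_ge: "B \<subseteq> F_ge t"
    and indep_coeff_mem: "lin_comb c B \<in> F_gt t \<Longrightarrow> b \<in> B \<Longrightarrow> c b \<in> m"
  using assms unfolding indep_def by blast+

lemma lin_comb_scale: "lin_comb (\<lambda>b. r * c b) B = to_fract r * lin_comb c B"
  by (simp add: lin_comb_def sum_distrib_left mult.assoc)

lemma lin_comb_insert:
  "finite B \<Longrightarrow> x \<notin> B \<Longrightarrow> lin_comb c (insert x B) = to_fract (c x) * x + lin_comb c B"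
  by (simp add: lin_comb_def)

lemma lin_comb_cong: "(\<And>b. b \<in> B \<Longrightarrow> c b = c' b) \<Longrightarrow> lin_comb c B = lin_comb c' B"
  by (simp add: lin_comb_def)

lemma lin_comb_single:
  assumes "finite B" and "b \<in> B"
  shows "lin_comb (\<lambda>x. of_bool (x = b)) B = b"
proof -
  have "lin_comb (\<lambda>x. of_bool (x = b)) B = (\<Sum>x\<in>B. if x = b then x else 0)"
    unfolding lin_comb_def by (rule sum.cong) auto
  then show ?thesis
    using assms by simp
qed

lemma spans_base: "finite B \<Longrightarrow> b \<in> B \<Longrightarrow> spans t B b"
  unfolding spans_def by (intro exI[of _ "\<lambda>x. of_bool (x = b)"]) (simp add: lin_comb_single)

lemma spans_insert:
  assumes "finite B" and "x \<notin> B" and "spans t B (y - to_fract r * x)"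
  shows "spans t (insert x B) y"
proof -
  obtain c where "y - to_fract r * x - lin_comb c B \<in> F_gt t"
    using assms(3) unfolding spans_def by blast
  moreover have "lin_comb (c(x := r)) (insert x B) = to_fract r * x + lin_comb c B"
    unfolding lin_comb_insert[OF assms(1,2)] using assms(2) by (auto intro: lin_comb_cong)
  ultimately show ?thesis
    unfolding spans_def by (intro exI[of _ "c(x := r)"]) (simp add: diff_diff_eq)
qed

lemma spans_add_F_gt:
  assumes "spans t B (y - z)" and "z \<in> F_gt t"
  shows "spans t B y"
proof -
  obtain c where "y - z - lin_comb c B \<in> F_gt t"
    using assms(1) unfolding spans_def by blast
  from F_gt_add[OF this assms(2)] have "y - lin_comb c B \<in> F_gt t"
    by (simp add: algebra_simps)
  then show ?thesis
    unfolding spans_def by blast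
qed

lemma indep_mem_value:
  assumes "indep t B" and "b \<in> B"
  shows "b \<noteq> 0" and "W b = t"
proof -
  have "b \<notin> F_gt t"
    using indep_coeff_mem[OF assms(1), of "\<lambda>x. of_bool (x = b)" b] assms(2)
      lin_comb_single[OF indep_finite[OF assms(1)] assms(2)] one_not_mem_max by auto
  then show "b \<noteq> 0" "W b = t"
    using indep_subset_F_ge[OF assms(1)] assms(2) by (auto simp: F_ge_def F_gt_def)
qed

lemma indep_empty [simp]: "indep t {}"
  by (simp add: indep_def)

lemma indep_insert:
  assumes "indep t B" and "x \<in> F_ge t" and "\<not> spans t B x"
  shows "x \<notin> B" and "indep t (insert x B)"
proof -
  note B = indepD[OF assms(1)]
  show "x \<notin> B"
    using assms(3) spans_base B(1) by blast
  have "\<forall>b\<in>insert x B. c b \<in> m" if comb: "lin_comb c (insert x B) \<in> F_gt t" for c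
  proof -
    have "c x \<in> m"
    proof (rule ccontr)
      assume "c x \<notin> m"
      then obtain r where "c x * r = 1"
        using local_ring_dvd_one[OF local_ring] by (metis dvdE)
      have "to_fract r * lin_comb c (insert x B) = to_fract (c x * r) * x + lin_comb (\<lambda>b. r * c b) B"
        using B(1) \<open>x \<notin> B\<close> by (simp add: lin_comb_insert lin_comb_scale distrib_left mult_ac)
      also have "\<dots> = x - lin_comb (\<lambda>b. - r * c b) B"
        unfolding lin_comb_scale by (simp add: \<open>c x * r = 1\<close>)
      finally show False
        using to_fract_mult_F_gt[OF comb] assms(3) unfolding spans_def by metis
    qed
    moreover have "lin_comb c B \<in> F_gt t"
      using F_gt_diff[OF comb max_mult_F_ge[OF \<open>c x \<in> m\<close> assms(2)]] B(1) \<open>x \<notin> B\<close>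
      by (simp add: lin_comb_insert)
    ultimately show ?thesis
      using B(3) by blast
  qed
  then show "indep t (insert x B)"
    using B assms(2) unfolding indep_def by simp
qed

lemma indep_card_le_spanning:
  assumes "indep t A" and "finite B" and "B \<subseteq> F_ge t" and "\<And>x. x \<in> A \<Longrightarrow> spans t B x"
  shows "card A \<le> card B"
proof (rule ccontr)
  note A = indepD[OF assms(1)]
  assume "\<not> card A \<le> card B"
  obtain c where c: "\<And>x. x \<in> A \<Longrightarrow> x - lin_comb (c x) B \<in> F_gt t"
    using assms(4) unfolding spans_def by metis
  obtain k where k: "\<exists>x\<in>A. k x \<notin> m" "\<And>b. b \<in> B \<Longrightarrow> (\<Sum>x\<in>A. k x * c x b) \<in> m"
    using nontrivial_relation_mod_prime[OF prime_ideal_max assms(2) A(1), of c] \<open>\<not> card A \<le> card B\<close>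
    by auto
  have "lin_comb k A
      = (\<Sum>x\<in>A. to_fract (k x) * (x - lin_comb (c x) B)) + (\<Sum>x\<in>A. to_fract (k x) * lin_comb (c x) B)"
    by (simp add: lin_comb_def[of k] right_diff_distrib sum_subtractf)
  also have "(\<Sum>x\<in>A. to_fract (k x) * lin_comb (c x) B) = (\<Sum>b\<in>B. to_fract (\<Sum>x\<in>A. k x * c x b) * b)"
    unfolding lin_comb_def to_fract_sum sum_distrib_left sum_distrib_right
    by (subst sum.swap) (simp add: mult.assoc)
  also have "(\<Sum>x\<in>A. to_fract (k x) * (x - lin_comb (c x) B)) + \<dots> \<in> F_gt t"
    using k(2) assms(3) c
    by (intro F_gt_add F_gt_sum to_fract_mult_F_gt max_mult_F_ge) blast+
  finally have "lin_comb k A \<in> F_gt t" .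
  then show False
    using A(3) k(1) by blast
qed

lemma indep_scale:
  assumes "z \<noteq> 0" and "indep t B"
  shows "indep (t + W z) ((\<lambda>x. x * z) ` B)"
proof -
  note B = indepD[OF assms(2)]
  have "inj_on (\<lambda>x. x * z) B"
    using assms(1) by (simp add: inj_on_def)
  then have "lin_comb c ((\<lambda>x. x * z) ` B) = lin_comb (\<lambda>x. c (x * z)) B * z" for c
    by (simp add: lin_comb_def sum.reindex sum_distrib_right mult.assoc)
  then have "c (x * z) \<in> m" if "lin_comb c ((\<lambda>x. x * z) ` B) \<in> F_gt (t + W z)" "x \<in> B" for c x
    using that B(3) assms(1) by (simp add: mult_right_mem_F_gt_iff)
  then show ?thesis
    using B(1,2) assms(1) unfolding indep_def by (auto simp: mult_right_mem_F_ge_iff)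
qed

lemma indep_normalize:
  assumes "indep t B" and "b \<in> B"
  shows "indep 0 ((\<lambda>x. x * inverse b) ` B)" and "card ((\<lambda>x. x * inverse b) ` B) = card B"
proof -
  have b: "b \<noteq> 0" "W b = t"
    using indep_mem_value[OF assms] by auto
  then show "indep 0 ((\<lambda>x. x * inverse b) ` B)"
    using indep_scale[OF _ assms(1), of "inverse b"] by (simp add: W_inverse)
  show "card ((\<lambda>x. x * inverse b) ` B) = card B"
    using b(1) by (intro card_image) (simp add: inj_on_def)
qed

lemma card_indep_bounded: "\<exists>N. \<forall>t B. indep t B \<longrightarrow> card B \<le> N"
proof -
  obtain G where G: "finite G" "G \<subseteq> F_ge 0" "\<And>y. y \<in> F_ge 0 \<Longrightarrow> spans 0 G y"
    using residue_finite unfolding spans_def lin_comb_def by blast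
  have card_le: "card B \<le> card G" if "indep 0 B" for B
    using indep_card_le_spanning[OF that G(1,2)] G(3) indep_subset_F_ge[OF that] by blast
  have "card B \<le> card G" if "indep t B" for t B
  proof (cases "B = {}")
    case False
    then obtain b where "b \<in> B"
      by blast
    then show ?thesis
      using card_le[OF indep_normalize(1)[OF that]] indep_normalize(2)[OF that] by simp
  qed simp
  then show ?thesis
    by blast
qed

lemma finite_card_indep: "finite (card ` {B. B \<subseteq> X \<and> indep t B})"
proof -
  obtain N where "\<forall>t B. indep t B \<longrightarrow> card B \<le> N"
    using card_indep_bounded by blast
  then have "card ` {B. B \<subseteq> X \<and> indep t B} \<subseteq> {..N}"
    by blast
  then show ?thesis
    by (rule finite_subset) simp
qed

lemma card_le_rank: "B \<subseteq> X \<Longrightarrow> indep t B \<Longrightarrow> card B \<le> rank t X"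
  unfolding rank_def by (intro Max_ge finite_card_indep) blast

lemma rank_le: "(\<And>B. B \<subseteq> X \<Longrightarrow> indep t B \<Longrightarrow> card B \<le> n) \<Longrightarrow> rank t X \<le> n"
  unfolding rank_def using indep_empty by (subst Max_le_iff[OF finite_card_indep]) blast+

lemma rank_mono: "X \<subseteq> Y \<Longrightarrow> rank t X \<le> rank t Y"
  by (rule rank_le) (blast intro: card_le_rank)

lemma rank_le_card_spanning:
  assumes "finite B" and "B \<subseteq> F_ge t" and "\<And>x. x \<in> X \<Longrightarrow> x \<in> F_ge t \<Longrightarrow> spans t B x"
  shows "rank t X \<le> card B"
  using assms indep_subset_F_ge by (intro rank_le indep_card_le_spanning[of t]) blast+

lemma ex_basis:
  "\<exists>B\<subseteq>X. indep t B \<and> card B = rank t X \<and> (\<forall>x\<in>X. x \<in> F_ge t \<longrightarrow> spans t B x)"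
proof -
  have "rank t X \<in> card ` {B. B \<subseteq> X \<and> indep t B}"
    unfolding rank_def using indep_empty by (intro Max_in finite_card_indep) blast
  then obtain B where B: "B \<subseteq> X" "indep t B" "card B = rank t X"
    by auto
  have "spans t B x" if "x \<in> X" "x \<in> F_ge t" for x
  proof (rule ccontr)
    assume "\<not> spans t B x"
    note insert = indep_insert[OF B(2) that(2) this]
    have "card (insert x B) \<le> rank t X"
      using B(1) that(1) insert(2) by (intro card_le_rank) auto
    then show False
      using insert(1) B(3) indep_finite[OF B(2)] by simp
  qed
  then show ?thesis
    using B by blast
qed

lemma rank_le_residue_degree: "rank t X \<le> residue_degree"
proof (rule rank_le)
  fix B
  assume "indep t B"
  show "card B \<le> residue_degree"
  proof (cases "B = {}")
    case False
    then obtain b where "b \<in> B"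
      by blast
    then show ?thesis
      using card_le_rank[OF subset_UNIV indep_normalize(1)[OF \<open>indep t B\<close>]]
        indep_normalize(2)[OF \<open>indep t B\<close>] by (simp add: residue_degree_def)
  qed simp
qed

lemma residue_degree_pos: "0 < residue_degree"
proof -
  have "indep 0 {1}"
    by (auto simp: indep_def lin_comb_def mem_max_iff F_ge_def)
  then have "card {1 :: 'a fract} \<le> residue_degree"
    unfolding residue_degree_def by (intro card_le_rank) simp_all
  then show ?thesis
    by simp
qed

subsection \<open>Colength as a sum of ranks\<close>

definition value_set :: "'a set \<Rightarrow> real set" where
  "value_set J = {W (to_fract x) |x. x \<in> J \<and> x \<noteq> 0}"

definition gr_rank :: "real \<Rightarrow> 'a set \<Rightarrow> nat" where
  "gr_rank t J = rank t (to_fract ` J)"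

definition valuation_ideal :: "real \<Rightarrow> 'a set" where
  "valuation_ideal t = {x. to_fract x \<in> F_ge t}"

lemma is_ideal_valuation_ideal: "is_ideal (valuation_ideal t)"
  unfolding is_ideal_def valuation_ideal_def by (auto intro: F_ge_add to_fract_mult_F_ge)

lemma valuation_ideal_antimono: "s \<le> t \<Longrightarrow> valuation_ideal t \<subseteq> valuation_ideal s"
  unfolding valuation_ideal_def using F_ge_antimono by blast

lemma value_set_mono: "J \<subseteq> K \<Longrightarrow> value_set J \<subseteq> value_set K"
  unfolding value_set_def by blast

lemma gr_rank_mono: "J \<subseteq> K \<Longrightarrow> gr_rank t J \<le> gr_rank t K"
  unfolding gr_rank_def by (intro rank_mono image_mono)

lemma gr_rank_eq_0:
  assumes "t \<notin> value_set J"
  shows "gr_rank t J = 0"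
proof -
  have "card B = 0" if "B \<subseteq> to_fract ` J" "indep t B" for B
  proof -
    have "b \<notin> B" for b
      using that(1) indep_mem_value[OF that(2), of b] assms unfolding value_set_def by fastforce
    then have "B = {}"
      by blast
    then show ?thesis
      by simp
  qed
  then have "rank t (to_fract ` J) \<le> 0"
    by (intro rank_le) simp
  then show ?thesis
    by (simp add: gr_rank_def)
qed

lemma card_le_gr_rank_shift:
  assumes J: "is_ideal J" and y: "y \<in> J" "y \<noteq> 0" and b: "b \<noteq> 0" and B: "indep 0 B"
    and denominator: "\<And>x. x \<in> B \<Longrightarrow> \<exists>g. x * to_fract b = to_fract g"
  shows "card B \<le> gr_rank (W (to_fract b) + W (to_fract y)) J"
proof -
  let ?z = "to_fract (b * y)"
  have z: "?z \<noteq> 0" "W ?z = W (to_fract b) + W (to_fract y)"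
    using W_mult[of "to_fract b" "to_fract y"] b y(2) by simp_all
  have "(\<lambda>x. x * ?z) ` B \<subseteq> to_fract ` J"
  proof clarify
    fix x
    assume "x \<in> B"
    then obtain g where "x * to_fract b = to_fract g"
      using denominator by blast
    then have "x * ?z = to_fract (g * y)"
      by (simp add: mult.assoc[symmetric])
    then show "x * ?z \<in> to_fract ` J"
      using is_ideal_mult[OF J y(1)] by blast
  qed
  moreover have "indep (W (to_fract b) + W (to_fract y)) ((\<lambda>x. x * ?z) ` B)"
    using indep_scale[OF z(1) B] z(2) by simp
  ultimately have "card ((\<lambda>x. x * ?z) ` B) \<le> gr_rank (W (to_fract b) + W (to_fract y)) J"
    unfolding gr_rank_def by (rule card_le_rank)
  moreover have "card ((\<lambda>x. x * ?z) ` B) = card B"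
    using z(1) by (intro card_image) (simp add: inj_on_def)
  ultimately show ?thesis
    by simp
qed

lemma ex_shift_full_gr_rank:
  "\<exists>v\<ge>0. \<forall>J. \<forall>t\<in>value_set J. is_ideal J \<longrightarrow> v + t \<in> value_set J \<and> gr_rank (v + t) J = residue_degree"
proof -
  obtain B where B: "indep 0 B" "card B = residue_degree"
    using ex_basis[of UNIV 0] unfolding residue_degree_def by blast
  obtain b where b: "b \<noteq> 0" "\<And>x. x \<in> B \<Longrightarrow> \<exists>g. x * to_fract b = to_fract g"
    using ex_common_denominator[OF indep_finite[OF B(1)]] by blast
  have "W (to_fract b) + t \<in> value_set J \<and> gr_rank (W (to_fract b) + t) J = residue_degree"
    if J: "is_ideal J" and t: "t \<in> value_set J" for J t
  proof
    obtain y where y: "y \<in> J" "y \<noteq> 0" "t = W (to_fract y)"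
      using t unfolding value_set_def by blast
    have "b * y \<in> J" "b * y \<noteq> 0" "W (to_fract (b * y)) = W (to_fract b) + t"
      using is_ideal_mult[OF J y(1)] b(1) y(2,3) by (simp_all add: W_mult)
    then show "W (to_fract b) + t \<in> value_set J"
      unfolding value_set_def by force
    show "gr_rank (W (to_fract b) + t) J = residue_degree"
      using card_le_gr_rank_shift[OF J y(1,2) b(1) B(1) b(2)] rank_le_residue_degree
      unfolding gr_rank_def y(3) B(2) by (simp add: le_antisym)
  qed
  then show ?thesis
    using W_to_fract_nonneg[OF b(1)] by blast
qed

lemma lin_comb_mem_ideal:
  assumes "is_ideal J" and "B \<subseteq> to_fract ` J"
  shows "lin_comb c B \<in> to_fract ` J"
proof -
  obtain C where C: "C \<subseteq> J" "B = to_fract ` C"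
    using assms(2) by (rule subset_imageE)
  have "lin_comb c B = to_fract (\<Sum>y\<in>C. c (to_fract y) * y)"
    by (simp add: C(2) lin_comb_def sum.reindex inj_on_def to_fract_sum)
  moreover have "(\<Sum>y\<in>C. c (to_fract y) * y) \<in> J"
    using C(1) by (intro is_ideal_sum is_ideal_mult assms(1)) blast
  ultimately show ?thesis
    by blast
qed

lemma gr_rank_less:
  assumes "is_ideal J" and "is_ideal K" and "J \<subseteq> K" and x: "x \<in> K - J"
    and max: "\<And>y. y \<in> K - J \<Longrightarrow> W (to_fract y) \<le> W (to_fract x)"
  shows "gr_rank (W (to_fract x)) J < gr_rank (W (to_fract x)) K"
proof -
  let ?t = "W (to_fract x)"
  obtain B where B: "B \<subseteq> to_fract ` J" "indep ?t B" "card B = gr_rank ?t J"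
    using ex_basis[of "to_fract ` J" ?t] unfolding gr_rank_def by blast
  have "\<not> spans ?t B (to_fract x)"
  proof
    assume "spans ?t B (to_fract x)"
    then obtain c where c: "to_fract x - lin_comb c B \<in> F_gt ?t"
      unfolding spans_def by blast
    obtain j where j: "j \<in> J" "lin_comb c B = to_fract j"
      using lin_comb_mem_ideal[OF assms(1) B(1)] by blast
    have "x - j \<in> K - J"
      using is_ideal_diff[OF assms(2)] is_ideal_add[OF assms(1) _ j(1), of "x - j"] j(1) x assms(3) by auto
    moreover have "x - j \<noteq> 0"
      using x j(1) by auto
    ultimately show False
      using max[of "x - j"] c unfolding j(2) to_fract_diff[symmetric]
      by (simp add: F_gt_def del: to_fract_diff)
  qed
  note insert = indep_insert[OF B(2) _ this]
  have "to_fract x \<in> F_ge ?t"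
    by (simp add: F_ge_def)
  then have "card (insert (to_fract x) B) \<le> gr_rank ?t K"
    unfolding gr_rank_def using B(1) x assms(3) by (intro card_le_rank insert) auto
  then show ?thesis
    using insert(1) \<open>to_fract x \<in> F_ge ?t\<close> B(3) indep_finite[OF B(2)] by simp
qed

lemma spans_ideal_gen_insert:
  assumes J: "is_ideal J" and max: "\<And>y. y \<notin> J \<Longrightarrow> W (to_fract y) \<le> W (to_fract x)"
    and B: "finite B" "to_fract x \<notin> B" "\<And>y. y \<in> J \<Longrightarrow> to_fract y \<in> F_ge t \<Longrightarrow> spans t B (to_fract y)"
    and y: "y \<in> ideal_gen (insert x J)" "to_fract y \<in> F_ge t"
  shows "spans t (if t = W (to_fract x) then insert (to_fract x) B else B) (to_fract y)"
proof -
  let ?x = "to_fract x"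
  obtain r where r: "y - r * x \<in> J"
    using y(1) unfolding mem_ideal_gen_insert[OF J] by blast
  have diff: "spans t B (to_fract y - to_fract r * ?x)" if "t \<le> W ?x"
  proof -
    have "?x \<in> F_ge t"
      using that by (simp add: F_ge_def)
    then show ?thesis
      using B(3)[OF r] F_ge_diff[OF y(2) to_fract_mult_F_ge] by simp
  qed
  consider (equal) "t = W ?x" | (less) "t < W ?x" | (greater) "W ?x < t"
    by linarith
  then show ?thesis
  proof cases
    case equal
    then show ?thesis
      using diff B(1,2) by (simp add: spans_insert)
  next
    case less
    then have "to_fract r * ?x \<in> F_gt t"
      by (intro to_fract_mult_F_gt) (simp add: F_gt_def)
    then show ?thesis
      using less diff spans_add_F_gt by simp
  next
    case greater
    then have "y \<in> J"
      using max[of y] y(2) is_ideal_zero[OF J] by (force simp: F_ge_def)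
    then show ?thesis
      using greater B(3) y(2) by simp
  qed
qed

lemma gr_rank_insert_le:
  assumes J: "is_ideal J" and "x \<notin> J" and max: "\<And>y. y \<notin> J \<Longrightarrow> W (to_fract y) \<le> W (to_fract x)"
  shows "gr_rank t (ideal_gen (insert x J)) \<le> gr_rank t J + of_bool (t = W (to_fract x))"
proof -
  obtain B where B: "B \<subseteq> to_fract ` J" "indep t B" "card B = gr_rank t J"
    and span: "\<And>y. y \<in> J \<Longrightarrow> to_fract y \<in> F_ge t \<Longrightarrow> spans t B (to_fract y)"
    using ex_basis[of "to_fract ` J" t] unfolding gr_rank_def by blast
  have x: "to_fract x \<notin> B"
    using B(1) assms(2) by auto
  define B' where "B' = (if t = W (to_fract x) then insert (to_fract x) B else B)"
  have "spans t B' (to_fract y)" if "y \<in> ideal_gen (insert x J)" "to_fract y \<in> F_ge t" for y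
    unfolding B'_def by (rule spans_ideal_gen_insert[OF J max indep_finite[OF B(2)] x span that])
  moreover have "B' \<subseteq> F_ge t" "finite B'"
    using indep_subset_F_ge[OF B(2)] indep_finite[OF B(2)] by (auto simp: B'_def F_ge_def)
  ultimately have "gr_rank t (ideal_gen (insert x J)) \<le> card B'"
    unfolding gr_rank_def by (intro rank_le_card_spanning) auto
  also have "\<dots> \<le> gr_rank t J + of_bool (t = W (to_fract x))"
    using x indep_finite[OF B(2)] by (simp add: B'_def flip: B(3))
  finally show ?thesis .
qed

definition total_rank :: "real \<Rightarrow> 'a set \<Rightarrow> nat" where
  "total_rank \<tau> J = (\<Sum>t | t \<in> value_set UNIV \<and> t < \<tau>. gr_rank t J)"

definition value_count :: "real \<Rightarrow> 'a set \<Rightarrow> nat" where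
  "value_count \<tau> J = card {t \<in> value_set J. t < \<tau>}"

lemma total_rank_mono: "J \<subseteq> K \<Longrightarrow> total_rank \<tau> J \<le> total_rank \<tau> K"
  unfolding total_rank_def by (intro sum_mono gr_rank_mono)

lemma total_rank_le:
  assumes "finite {t \<in> value_set UNIV. t < \<tau>}"
  shows "total_rank \<tau> J \<le> residue_degree * value_count \<tau> J"
proof -
  have sub: "{t \<in> value_set J. t < \<tau>} \<subseteq> {t \<in> value_set UNIV. t < \<tau>}"
    using value_set_mono[of J UNIV] by auto
  have "total_rank \<tau> J = (\<Sum>t | t \<in> value_set J \<and> t < \<tau>. gr_rank t J)"
    unfolding total_rank_def using assms sub gr_rank_eq_0 by (intro sum.mono_neutral_right) blast+
  also have "\<dots> \<le> (\<Sum>t | t \<in> value_set J \<and> t < \<tau>. residue_degree)"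
    unfolding gr_rank_def by (intro sum_mono rank_le_residue_degree)
  finally show ?thesis
    by (simp add: value_count_def mult.commute)
qed

lemma ex_shift_total_rank_ge:
  assumes finite: "\<And>\<tau>. finite {t \<in> value_set UNIV. t < \<tau>}"
  shows "\<exists>v\<ge>0. \<forall>J \<tau>. is_ideal J \<longrightarrow> residue_degree * value_count (\<tau> - v) J \<le> total_rank \<tau> J"
proof -
  obtain v where v: "0 \<le> v" and shift: "\<And>J t. t \<in> value_set J \<Longrightarrow> is_ideal J \<Longrightarrow>
      v + t \<in> value_set J \<and> gr_rank (v + t) J = residue_degree"
    using ex_shift_full_gr_rank by blast
  have "residue_degree * value_count (\<tau> - v) J \<le> total_rank \<tau> J" if J: "is_ideal J" for J \<tau>
  proof -
    let ?A = "{t \<in> value_set J. t < \<tau> - v}"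
    have "residue_degree * value_count (\<tau> - v) J = (\<Sum>t\<in>?A. gr_rank (v + t) J)"
      using shift J by (simp add: value_count_def)
    also have "\<dots> = (\<Sum>t\<in>(+) v ` ?A. gr_rank t J)"
      by (simp add: sum.reindex)
    also have "\<dots> \<le> total_rank \<tau> J"
      unfolding total_rank_def using shift[OF _ J] value_set_mono[of J UNIV]
      by (intro sum_mono2 finite) auto
    finally show ?thesis .
  qed
  then show ?thesis
    using v by blast
qed

lemma ex_max_value:
  assumes "finite {t \<in> value_set UNIV. t < \<tau>}" and "X \<noteq> {}" and "X \<inter> valuation_ideal \<tau> = {}"
  shows "\<exists>x\<in>X. \<forall>y\<in>X. W (to_fract y) \<le> W (to_fract x)"
proof -
  have "(\<lambda>y. W (to_fract y)) ` X \<subseteq> {t \<in> value_set UNIV. t < \<tau>}"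
    using assms(3) unfolding valuation_ideal_def value_set_def F_ge_def by fastforce
  then have finite: "finite ((\<lambda>y. W (to_fract y)) ` X)"
    using assms(1) by (rule finite_subset)
  have "Max ((\<lambda>y. W (to_fract y)) ` X) \<in> (\<lambda>y. W (to_fract y)) ` X"
    using finite assms(2) by (intro Max_in) simp_all
  then obtain x where "x \<in> X" "Max ((\<lambda>y. W (to_fract y)) ` X) = W (to_fract x)"
    by blast
  then show ?thesis
    using Max_ge[OF finite] by (metis imageI)
qed

lemma total_rank_less:
  assumes finite: "finite {t \<in> value_set UNIV. t < \<tau>}" and "is_ideal J" and "is_ideal K"
    and "J \<subset> K" and deep: "valuation_ideal \<tau> \<subseteq> J"
  shows "total_rank \<tau> J < total_rank \<tau> K"
proof -
  obtain x where x: "x \<in> K - J" "\<And>y. y \<in> K - J \<Longrightarrow> W (to_fract y) \<le> W (to_fract x)"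
    using ex_max_value[OF finite, of "K - J"] assms(4) deep by blast
  have "x \<noteq> 0" "W (to_fract x) < \<tau>"
    using x(1) deep is_ideal_zero[OF assms(2)] by (auto simp: valuation_ideal_def F_ge_def not_le[symmetric])
  then have "W (to_fract x) \<in> {t \<in> value_set UNIV. t < \<tau>}"
    unfolding value_set_def by blast
  moreover have "gr_rank (W (to_fract x)) J < gr_rank (W (to_fract x)) K"
    using assms(2-4) x by (intro gr_rank_less) auto
  ultimately show ?thesis
    unfolding total_rank_def using assms(4)
    by (intro sum_strict_mono_ex1 finite ballI gr_rank_mono) auto
qed

lemma ex_total_rank_step:
  assumes finite: "finite {t \<in> value_set UNIV. t < \<tau>}" and "is_ideal J" and "J \<noteq> UNIV"
    and deep: "valuation_ideal \<tau> \<subseteq> J"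
  shows "\<exists>K. is_ideal K \<and> J \<subset> K \<and> total_rank \<tau> K \<le> Suc (total_rank \<tau> J)"
proof -
  obtain x where x: "x \<notin> J" "\<And>y. y \<notin> J \<Longrightarrow> W (to_fract y) \<le> W (to_fract x)"
    using ex_max_value[OF finite, of "- J"] assms(3) deep by blast
  have "total_rank \<tau> (ideal_gen (insert x J))
      \<le> (\<Sum>t | t \<in> value_set UNIV \<and> t < \<tau>. gr_rank t J + of_bool (t = W (to_fract x)))"
    unfolding total_rank_def by (intro sum_mono gr_rank_insert_le assms(2) x)
  also have "\<dots> \<le> Suc (total_rank \<tau> J)"
    using finite by (simp add: sum.distrib total_rank_def of_bool_def)
  finally show ?thesis
    using x(1) ideal_gen_base[of _ "insert x J"] by (intro exI[of _ "ideal_gen (insert x J)"]) auto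
qed

lemma colength_add_total_rank:
  assumes finite: "finite {t \<in> value_set UNIV. t < \<tau>}" and J: "is_ideal J" "valuation_ideal \<tau> \<subseteq> J"
  shows "colength J + total_rank \<tau> J = total_rank \<tau> UNIV"
proof -
  have "colength J = total_rank \<tau> UNIV - total_rank \<tau> J"
  proof (rule colength_eqI[where \<phi> = "\<lambda>K. total_rank \<tau> UNIV - total_rank \<tau> K"])
    fix K K' :: "'a set"
    assume K: "is_ideal K" "is_ideal K'" "J \<subseteq> K" "K \<subset> K'"
    then have "total_rank \<tau> K < total_rank \<tau> K'"
      using J(2) by (intro total_rank_less finite) auto
    also have "\<dots> \<le> total_rank \<tau> UNIV"
      by (intro total_rank_mono subset_UNIV)
    finally show "total_rank \<tau> UNIV - total_rank \<tau> K' < total_rank \<tau> UNIV - total_rank \<tau> K"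
      using \<open>total_rank \<tau> K < total_rank \<tau> K'\<close> by linarith
  next
    fix K :: "'a set"
    assume K: "is_ideal K" "J \<subseteq> K" "K \<noteq> UNIV"
    then obtain K' where "is_ideal K'" "K \<subset> K'" "total_rank \<tau> K' \<le> Suc (total_rank \<tau> K)"
      using ex_total_rank_step[OF finite, of K] J(2) by blast
    then show "\<exists>K'. is_ideal K' \<and> K \<subset> K' \<and>
        total_rank \<tau> UNIV - total_rank \<tau> K \<le> Suc (total_rank \<tau> UNIV - total_rank \<tau> K')"
      by (intro exI[of _ K']) auto
  qed (use J(1) in simp_all)
  then show ?thesis
    using total_rank_mono[of J UNIV] by simp
qed

end

section \<open>OK domains\<close>

lemma ex_coordinatewise_convergent_subseq:
  fixes X :: "nat \<Rightarrow> nat \<Rightarrow> real"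
  assumes "\<And>n i. \<bar>X n i\<bar> \<le> B"
  shows "\<exists>r. strict_mono r \<and> (\<forall>i<k. convergent (\<lambda>n. X (r n) i))"
proof (induction k)
  case 0
  show ?case
    by (intro exI[of _ id]) (simp add: strict_mono_def)
next
  case (Suc k)
  then obtain r where r: "strict_mono r" "\<And>i. i < k \<Longrightarrow> convergent (\<lambda>n. X (r n) i)"
    by blast
  obtain f :: "nat \<Rightarrow> nat" where f: "strict_mono f" "monoseq (\<lambda>n. X (r (f n)) k)"
    using seq_monosub[of "\<lambda>n. X (r n) k"] by blast
  have "Bseq (\<lambda>n. X (r (f n)) k)"
    using assms by (intro BseqI'[of _ B]) simp
  then have "convergent (\<lambda>n. X (r (f n)) k)"
    using f(2) by (rule Bseq_monoseq_convergent)
  moreover have "convergent (\<lambda>n. X (r (f n)) i)" if "i < k" for i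
    using convergent_subseq_convergent[OF r(2)[OF that] f(1)] by (simp add: comp_def)
  ultimately show ?case
    using r(1) f(1) by (intro exI[of _ "r \<circ> f"]) (auto simp: less_Suc_eq strict_mono_def)
qed

lemma scaled_limit_mem_closed_cone_gen:
  assumes "\<And>n. u n \<in> S" and "\<And>n. 0 \<le> c n" and "\<And>i. (\<lambda>n. c n * real_of_int (u n i)) \<longlonglongrightarrow> l i"
  shows "l \<in> closed_cone_gen S"
proof -
  have "(\<lambda>i. c n * real_of_int (u n i)) \<in> cone_gen S" for n
    unfolding cone_gen_def using assms(1,2)
    by (intro CollectI exI[of _ "{u n}"] exI[of _ "\<lambda>_. c n"]) simp
  then show ?thesis
    unfolding closed_cone_gen_def using assms(3)
    by (intro CollectI exI[of _ "\<lambda>n i. c n * real_of_int (u n i)"]) blast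
qed

definition l1_norm :: "nat \<Rightarrow> (nat \<Rightarrow> int) \<Rightarrow> real" where
  "l1_norm d u = (\<Sum>i<d. \<bar>real_of_int (u i)\<bar>)"

lemma abs_le_l1_norm: "i < d \<Longrightarrow> \<bar>real_of_int (u i)\<bar> \<le> l1_norm d u"
  unfolding l1_norm_def by (intro member_le_sum) auto

lemma ex_limit_direction:
  fixes u :: "nat \<Rightarrow> nat \<Rightarrow> int"
  assumes S: "S \<subseteq> zvec d" and u: "\<And>n. u n \<in> S" and pos: "\<And>n. 0 < l1_norm d (u n)"
  shows "\<exists>l r. l \<in> closed_cone_gen S \<and> l \<noteq> (\<lambda>_. 0) \<and> strict_mono r \<and>
    (\<lambda>n. pair_a d a (u (r n)) / l1_norm d (u (r n))) \<longlonglongrightarrow> pair_real d a l"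
proof -
  define X where "X n i = 1 / l1_norm d (u n) * real_of_int (u n i)" for n i
  have outside: "X n i = 0" if "d \<le> i" for n i
    using S u[of n] that by (auto simp: X_def zvec_def)
  have "\<bar>X n i\<bar> \<le> 1" for n i
    using abs_le_l1_norm[of i d "u n"] pos[of n] outside[of i n]
    by (cases "i < d") (auto simp: X_def)
  then obtain r where r: "strict_mono r" "\<forall>i<d. convergent (\<lambda>n. X (r n) i)"
    using ex_coordinatewise_convergent_subseq[of X 1 d] by blast
  define l where "l i = lim (\<lambda>n. X (r n) i)" for i
  have lim: "(\<lambda>n. X (r n) i) \<longlonglongrightarrow> l i" for i
    using r(2) outside[of i] unfolding l_def convergent_LIMSEQ_iff[symmetric]
    by (cases "i < d") (auto intro: convergent_const)
  have "l \<in> closed_cone_gen S"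
    using u pos lim unfolding X_def
    by (intro scaled_limit_mem_closed_cone_gen[of "\<lambda>n. u (r n)" S "\<lambda>n. 1 / l1_norm d (u (r n))"])
      (simp_all add: less_imp_le)
  moreover have "(\<Sum>i<d. \<bar>X n i\<bar>) = 1" for n
    using pos[of n] by (simp add: X_def abs_mult l1_norm_def flip: sum_divide_distrib)
  then have "(\<Sum>i<d. \<bar>l i\<bar>) = 1"
    using tendsto_sum[of "{..<d}" "\<lambda>i n. \<bar>X (r n) i\<bar>" "\<lambda>i. \<bar>l i\<bar>" sequentially] lim
    by (simp add: tendsto_rabs LIMSEQ_const_iff)
  then have "l \<noteq> (\<lambda>_. 0)"
    by auto
  moreover have "pair_a d a (u (r n)) / l1_norm d (u (r n)) = pair_real d a (X (r n))" for n
    by (simp add: pair_a_def pair_real_def X_def sum_divide_distrib)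
  then have "(\<lambda>n. pair_a d a (u (r n)) / l1_norm d (u (r n))) \<longlonglongrightarrow> pair_real d a l"
    unfolding pair_real_def by (simp add: tendsto_sum tendsto_mult lim)
  ultimately show ?thesis
    using r(1) by blast
qed

lemma pair_a_nonneg_if_pos_on_closed_cone:
  assumes "\<And>l. l \<in> closed_cone_gen S \<Longrightarrow> l \<noteq> (\<lambda>_. 0) \<Longrightarrow> 0 < pair_real d a l" and "u \<in> S"
  shows "0 \<le> pair_a d a u"
proof -
  have "(\<lambda>i. real_of_int (u i)) \<in> closed_cone_gen S"
    using scaled_limit_mem_closed_cone_gen[of "\<lambda>_. u" S "\<lambda>_. 1"] assms(2) by simp
  then show ?thesis
    using assms(1) by (fastforce simp: pair_real_def pair_a_def fun_eq_iff)
qed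

lemma coercive_if_pos_on_closed_cone:
  assumes S: "S \<subseteq> zvec d"
    and pos: "\<And>l. l \<in> closed_cone_gen S \<Longrightarrow> l \<noteq> (\<lambda>_. 0) \<Longrightarrow> 0 < pair_real d a l"
  shows "\<exists>\<epsilon>>0. \<forall>u\<in>S. \<forall>i<d. \<epsilon> * \<bar>real_of_int (u i)\<bar> \<le> pair_a d a u"
proof -
  have "\<exists>\<epsilon>>0. \<forall>u\<in>S. \<epsilon> * l1_norm d u \<le> pair_a d a u"
  proof (rule ccontr)
    assume "\<not> ?thesis"
    then have "\<exists>u\<in>S. pair_a d a u < 1 / real (Suc n) * l1_norm d u" for n
      by (meson not_le of_nat_0_less_iff zero_less_Suc zero_less_divide_1_iff)
    then obtain u where u: "\<And>n. u n \<in> S" "\<And>n. pair_a d a (u n) < 1 / real (Suc n) * l1_norm d (u n)"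
      by metis
    have norm_pos: "0 < l1_norm d (u n)" for n
      using le_less_trans[OF pair_a_nonneg_if_pos_on_closed_cone[OF pos u(1)] u(2)]
      by (simp add: zero_less_divide_iff)
    obtain l r where l: "l \<in> closed_cone_gen S" "l \<noteq> (\<lambda>_. 0)" and r: "strict_mono r"
      and lim: "(\<lambda>n. pair_a d a (u (r n)) / l1_norm d (u (r n))) \<longlonglongrightarrow> pair_real d a l"
      using ex_limit_direction[of S d u a] S u(1) norm_pos by blast
    have "pair_a d a (u (r n)) / l1_norm d (u (r n)) \<le> inverse (real (Suc (r n)))" for n
      using u(2)[of "r n"] norm_pos[of "r n"] by (simp add: pos_divide_le_eq inverse_eq_divide less_imp_le)
    moreover have "(\<lambda>n. inverse (real (Suc (r n)))) \<longlonglongrightarrow> 0"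
      using LIMSEQ_subseq_LIMSEQ[OF LIMSEQ_inverse_real_of_nat r] by (simp add: comp_def)
    ultimately have "pair_real d a l \<le> 0"
      using LIMSEQ_le[OF lim] by blast
    then show False
      using pos[OF l] by simp
  qed
  then obtain \<epsilon> where \<epsilon>: "0 < \<epsilon>" "\<And>u. u \<in> S \<Longrightarrow> \<epsilon> * l1_norm d u \<le> pair_a d a u"
    by blast
  have "\<epsilon> * \<bar>real_of_int (u i)\<bar> \<le> pair_a d a u" if "u \<in> S" "i < d" for u i
  proof -
    have "\<epsilon> * \<bar>real_of_int (u i)\<bar> \<le> \<epsilon> * l1_norm d u"
      using \<epsilon>(1) abs_le_l1_norm[OF that(2)] by (intro mult_left_mono) simp_all
    then show ?thesis
      using \<epsilon>(2)[OF that(1)] by linarith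
  qed
  then show ?thesis
    using \<epsilon>(1) by blast
qed

locale ok_local_domain =
  fixes m :: "'a::idom set" and d :: nat and a :: "nat \<Rightarrow> real" and \<nu> :: "'a fract \<Rightarrow> nat \<Rightarrow> int"
  assumes local_ring_max: "local_ring_with_max m"
    and weights_indep: "rat_lin_indep d a"
    and ok: "ok_valuation d a m \<nu>"
begin

definition W :: "'a fract \<Rightarrow> real" where
  "W x = pair_a d a (\<nu> x)"

definition Val :: "'a set \<Rightarrow> (nat \<Rightarrow> int) set" where
  "Val J = {\<nu> (to_fract x) |x. x \<in> J \<and> x \<noteq> 0}"

lemma nu_image_nonzero: "\<nu> ` {x. x \<noteq> 0} = zvec d"
  and nu_mult: "x \<noteq> 0 \<Longrightarrow> y \<noteq> 0 \<Longrightarrow> \<nu> (x * y) = \<nu> x + \<nu> y"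
  using ok unfolding ok_valuation_def is_valuation_def plus_fun_def by (elim conjE; simp)+

lemma W_add_ge_min: "x \<noteq> 0 \<Longrightarrow> y \<noteq> 0 \<Longrightarrow> x + y \<noteq> 0 \<Longrightarrow> min (W x) (W y) \<le> W (x + y)"
  using ok unfolding ok_valuation_def is_valuation_def W_def by (elim conjE) simp

end

sublocale ok_local_domain \<subseteq> real_valuation W
  by standard (simp_all add: W_def nu_mult W_add_ge_min[unfolded W_def])

context ok_local_domain
begin

lemma val_ring_eq: "val_ring d a \<nu> = F_ge 0"
  and val_max_eq: "val_max d a \<nu> = F_gt 0"
  and val_ge_eq: "val_ge d a \<nu> u = F_ge (pair_a d a u)"
  by (auto simp: val_ring_def val_ge_def val_max_def F_ge_def F_gt_def W_def pair_a_def)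

end

sublocale ok_local_domain \<subseteq> valued_local_ring W m
proof
  show "local_ring_with_max m"
    by (rule local_ring_max)
  show "to_fract x \<in> F_ge 0" "x \<in> m \<longleftrightarrow> to_fract x \<in> F_gt 0" for x
    using ok unfolding ok_valuation_def to_fract_def val_ring_eq val_max_eq by blast+
  show "\<exists>B. finite B \<and> B \<subseteq> F_ge 0 \<and> (\<forall>y\<in>F_ge 0. \<exists>c. y - (\<Sum>b\<in>B. to_fract (c b) * b) \<in> F_gt 0)"
    using ok unfolding ok_valuation_def to_fract_def val_ring_eq val_max_eq by (elim conjE)
qed

context ok_local_domain
begin

lemma nu_mem_Val: "x \<in> J \<Longrightarrow> x \<noteq> 0 \<Longrightarrow> \<nu> (to_fract x) \<in> Val J"
  unfolding Val_def by blast

lemma Val_subset_zvec: "Val J \<subseteq> zvec d"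
  unfolding Val_def nu_image_nonzero[symmetric] by auto

lemma Val_mono: "J \<subseteq> K \<Longrightarrow> Val J \<subseteq> Val K"
  unfolding Val_def by blast

lemma Val_add:
  assumes "is_ideal J" and "u \<in> Val J" and "v \<in> Val UNIV"
  shows "u + v \<in> Val J"
proof -
  obtain x y where x: "x \<in> J" "x \<noteq> 0" "u = \<nu> (to_fract x)" and y: "y \<noteq> 0" "v = \<nu> (to_fract y)"
    using assms(2,3) unfolding Val_def by blast
  then have "u + v = \<nu> (to_fract (y * x))"
    by (simp add: nu_mult add.commute)
  moreover have "y * x \<in> J" "y * x \<noteq> 0"
    using x y is_ideal_mult[OF assms(1)] by auto
  ultimately show ?thesis
    unfolding Val_def by blast
qed

lemma nu_power: "x \<noteq> 0 \<Longrightarrow> \<nu> (x ^ n) = of_nat n * \<nu> x"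
proof (induction n)
  case 0
  then show ?case
    using nu_mult[of 1 1] by simp
qed (simp add: nu_mult distrib_right)

lemma valuation_ideal_subset_ideal_pow: "\<exists>v. \<forall>n. valuation_ideal (real n * pair_a d a v) \<subseteq> ideal_pow m n"
proof -
  have "\<exists>v\<in>zvec d. \<forall>n x. Fract x 1 \<in> val_ge d a \<nu> (\<lambda>i. int n * v i) \<longrightarrow> x \<in> ideal_pow m n"
    using ok unfolding ok_valuation_def by (elim conjE)
  then obtain v where v: "\<And>n x. Fract x 1 \<in> val_ge d a \<nu> (\<lambda>i. int n * v i) \<Longrightarrow> x \<in> ideal_pow m n"
    by blast
  have "(\<lambda>i. int n * v i) = of_nat n * v" for n
    by auto
  then have "valuation_ideal (real n * pair_a d a v) \<subseteq> ideal_pow m n" for n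
    using v[of _ n] by (auto simp: valuation_ideal_def val_ge_eq to_fract_def)
  then show ?thesis
    by blast
qed

lemma dimension_pos: "0 < d"
proof (rule ccontr)
  assume "\<not> 0 < d"
  then have "pair_a d a u = 0" for u
    by (simp add: pair_a_def)
  then have "valuation_ideal 0 \<subseteq> ideal_pow m 1"
    using valuation_ideal_subset_ideal_pow by (metis mult_zero_right)
  moreover have "1 \<in> valuation_ideal 0"
    unfolding valuation_ideal_def using to_fract_mem_F_ge by blast
  moreover have "ideal_pow m 1 \<subseteq> m"
    using ideal_pow_Suc_subset[OF is_ideal_max, of 0] by simp
  ultimately show False
    using one_not_mem_max by blast
qed

lemma nu_quotient:
  assumes "x * to_fract b = to_fract g" and "x \<noteq> 0" and "b \<noteq> 0"
  shows "\<nu> (to_fract g) - \<nu> (to_fract b) = \<nu> x"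
  using nu_mult[of x "to_fract b"] assms by simp

end

sublocale ok_local_domain \<subseteq> weighted_monoid d a "Val UNIV"
proof
  show "0 < d"
    by (rule dimension_pos)
  show "Val UNIV \<subseteq> zvec d"
    by (rule Val_subset_zvec)
  show "0 \<in> Val UNIV"
    using nu_mult[of 1 1] unfolding Val_def by (intro CollectI exI[of _ 1]) simp
  show "u + v \<in> Val UNIV" if "u \<in> Val UNIV" "v \<in> Val UNIV" for u v
    using that by (intro Val_add) simp_all
  show "\<exists>s\<in>Val UNIV. \<exists>s'\<in>Val UNIV. s - s' = (\<lambda>j. of_bool (j = i))" if "i < d" for i
  proof -
    have "(\<lambda>j. of_bool (j = i)) \<in> zvec d"
      using that by (simp add: zvec_def)
    then obtain x where x: "x \<noteq> 0" "\<nu> x = (\<lambda>j. of_bool (j = i))"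
      unfolding nu_image_nonzero[symmetric] by force
    obtain b g where bg: "b \<noteq> 0" "x * to_fract b = to_fract g"
      using ex_denominator by blast
    then have "g \<noteq> 0"
      using x(1) by (metis mult_eq_0_iff to_fract_eq_0_iff)
    then show ?thesis
      using nu_quotient[OF bg(2) x(1) bg(1)] x(2) bg(1) nu_mem_Val[of _ UNIV]
      by (intro bexI[of _ "\<nu> (to_fract g)"] bexI[of _ "\<nu> (to_fract b)"]) auto
  qed
  have "Val UNIV = \<nu> ` {Fract x 1 |x. x \<noteq> 0}"
    unfolding Val_def to_fract_def by blast
  moreover have "\<forall>u\<in>closed_cone_gen (\<nu> ` {Fract x 1 |x. x \<noteq> 0}). u \<noteq> (\<lambda>_. 0) \<longrightarrow> pair_real d a u > 0"
    using ok unfolding ok_valuation_def by (elim conjE)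
  ultimately show "\<exists>\<epsilon>>0. \<forall>u\<in>Val UNIV. \<forall>i<d. \<epsilon> * \<bar>real_of_int (u i)\<bar> \<le> pair_a d a u"
    by (intro coercive_if_pos_on_closed_cone Val_subset_zvec) simp
qed

context ok_local_domain
begin

lemma value_set_eq: "value_set J = wt ` Val J"
  unfolding value_set_def Val_def W_def by blast

lemma finite_value_set_below: "finite {t \<in> value_set UNIV. t < \<tau>}"
proof -
  have "{t \<in> value_set UNIV. t < \<tau>} = wt ` {u \<in> Val UNIV. wt u < \<tau>}"
    unfolding value_set_eq by blast
  then show ?thesis
    by (simp add: finite_below)
qed

lemma value_count_eq: "value_count \<tau> J = count_below (Val J) \<tau>"
proof -
  have "{t \<in> value_set J. t < \<tau>} = wt ` {u \<in> Val J. wt u < \<tau>}"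
    unfolding value_set_eq by blast
  moreover have "inj_on wt {u \<in> Val J. wt u < \<tau>}"
    by (rule inj_on_subset[OF pair_a_inj_on[OF weights_indep]]) (use Val_subset_zvec in blast)
  ultimately show ?thesis
    by (simp add: value_count_def count_below_def card_image)
qed

lemma ex_valuation_ideal_subset:
  "\<exists>\<kappa>>0. \<forall>K N. is_ideal K \<longrightarrow> (\<forall>x\<in>m. x ^ N \<in> K) \<longrightarrow> 0 < N \<longrightarrow> valuation_ideal (\<kappa> * real N) \<subseteq> K"
proof -
  obtain F where F: "finite F" "m = ideal_gen F"
    using local_ring_finitely_generated[OF local_ring is_ideal_max] by blast
  obtain v where v: "\<And>n. valuation_ideal (real n * wt v) \<subseteq> ideal_pow m n"
    using valuation_ideal_subset_ideal_pow by blast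
  define \<kappa> where "\<kappa> = (real (card F) + 1) * max 1 (wt v)"
  have "valuation_ideal (\<kappa> * real N) \<subseteq> K" if K: "is_ideal K" "\<forall>x\<in>m. x ^ N \<in> K" "0 < N" for K N
  proof -
    let ?n = "card F * N + 1"
    have "real ?n \<le> (real (card F) + 1) * real N"
      using K(3) by (simp add: distrib_right)
    then have "real ?n * max 1 (wt v) \<le> (real (card F) + 1) * real N * max 1 (wt v)"
      by (intro mult_right_mono) auto
    moreover have "real ?n * wt v \<le> real ?n * max 1 (wt v)"
      by (intro mult_left_mono) auto
    ultimately have "real ?n * wt v \<le> (real (card F) + 1) * real N * max 1 (wt v)"
      by linarith
    then have "valuation_ideal (\<kappa> * real N) \<subseteq> valuation_ideal (real ?n * wt v)"
      unfolding \<kappa>_def by (intro valuation_ideal_antimono) (simp add: mult_ac)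
    also have "\<dots> \<subseteq> ideal_pow m ?n"
      by (rule v)
    also have "\<dots> \<subseteq> K"
      unfolding F(2) using K(2) F(2) ideal_gen_base[of _ F] by (intro ideal_pow_gen_subset F(1) K(1)) blast
    finally show ?thesis .
  qed
  moreover have "0 < \<kappa>"
    unfolding \<kappa>_def by (intro mult_pos_pos) auto
  ultimately show ?thesis
    by blast
qed

lemma ex_valuation_ideal_subset_frob_pow: "\<exists>\<kappa>>0. \<forall>q>0. valuation_ideal (\<kappa> * real q) \<subseteq> frob_pow q m"
  using ex_valuation_ideal_subset is_ideal_frob_pow power_mem_frob_pow by metis

lemma ex_value_lower_bound_max: "\<exists>\<delta>>0. \<forall>t\<in>value_set m. \<delta> \<le> t"
proof -
  define D where "D = insert 1 {t \<in> value_set m. t < 1}"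
  have D: "finite D"
    unfolding D_def using value_set_mono[of m UNIV]
    by (intro finite.insertI finite_subset[OF _ finite_value_set_below[of 1]]) auto
  have "0 < t" if "t \<in> value_set m" for t
    using that by (auto simp: value_set_def mem_max_iff F_gt_def)
  then have "0 < Min D"
    using D by (subst Min_gr_iff) (auto simp: D_def)
  moreover have "Min D \<le> t" if "t \<in> value_set m" for t
    using Min_le[OF D, of t] Min_le[OF D, of 1] that by (cases "t < 1") (auto simp: D_def)
  ultimately show ?thesis
    by blast
qed

lemma ex_frob_pow_subset_valuation_ideal: "\<exists>\<delta>>0. \<forall>q. frob_pow q m \<subseteq> valuation_ideal (\<delta> * real q)"
proof -
  obtain \<delta> where \<delta>: "0 < \<delta>" "\<And>t. t \<in> value_set m \<Longrightarrow> \<delta> \<le> t"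
    using ex_value_lower_bound_max by blast
  have "frob_pow q m \<subseteq> valuation_ideal (\<delta> * real q)" for q
  proof (rule frob_pow_least[OF is_ideal_valuation_ideal])
    fix x
    assume "x \<in> m"
    show "x ^ q \<in> valuation_ideal (\<delta> * real q)"
    proof (cases "x = 0")
      case False
      then have "W (to_fract x) \<in> value_set m"
        using \<open>x \<in> m\<close> unfolding value_set_def by blast
      from \<delta>(2)[OF this] show ?thesis
        using False by (simp add: valuation_ideal_def F_ge_def to_fract_power W_power
            mult.commute[of \<delta>] mult_left_mono)
    next
      case True
      then show ?thesis
        by (cases "q = 0") (auto simp: valuation_ideal_def F_ge_def)
    qed
  qed
  then show ?thesis
    using \<delta>(1) by blast
qed

lemma ex_valuation_ideal_subset_p_family:
  assumes I: "p_family p I" and rad: "m \<subseteq> radical (I 0)" and "0 < p"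
  shows "\<exists>c\<ge>1. \<forall>e. valuation_ideal (c * real p ^ e) \<subseteq> I e"
proof -
  obtain F where F: "finite F" "m = ideal_gen F"
    using local_ring_finitely_generated[OF local_ring is_ideal_max] by blast
  obtain M where M: "\<And>x. x \<in> m \<Longrightarrow> x ^ M \<in> I 0"
    using ex_common_exponent[OF F(1) p_family_is_ideal[OF I], of 0] rad unfolding F(2) by blast
  obtain \<kappa> where \<kappa>: "\<And>K N. is_ideal K \<Longrightarrow> \<forall>x\<in>m. x ^ N \<in> K \<Longrightarrow> 0 < N \<Longrightarrow> valuation_ideal (\<kappa> * real N) \<subseteq> K"
    using ex_valuation_ideal_subset by blast
  define c where "c = max 1 (\<kappa> * real (Suc M))"
  have "valuation_ideal (c * real p ^ e) \<subseteq> I e" for e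
  proof -
    have "x ^ (Suc M * p ^ e) \<in> I e" if "x \<in> m" for x
    proof -
      have "x ^ Suc M \<in> I 0"
        using is_ideal_mult[OF p_family_is_ideal[OF I] M[OF that], of x] by simp
      from p_family_power[OF I this, of e] show ?thesis
        by (simp only: power_mult add_0)
    qed
    then have "valuation_ideal (\<kappa> * real (Suc M * p ^ e)) \<subseteq> I e"
      using \<open>0 < p\<close> by (intro \<kappa> p_family_is_ideal[OF I]) auto
    moreover have "\<kappa> * real (Suc M * p ^ e) \<le> c * real p ^ e"
      unfolding c_def of_nat_mult of_nat_power mult.assoc[symmetric] by (intro mult_right_mono) auto
    ultimately show ?thesis
      using valuation_ideal_antimono by blast
  qed
  moreover have "1 \<le> c"
    by (simp add: c_def)
  ultimately show ?thesis
    by blast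
qed

lemma p_system_Val:
  assumes "p_family p I"
  shows "p_system p (\<lambda>e. Val (I e))"
  unfolding p_system_def
proof (intro conjI allI ballI)
  show "Val (I e) \<subseteq> Val UNIV" for e
    by (intro Val_mono subset_UNIV)
  show "u + v \<in> Val (I e)" if "u \<in> Val (I e)" "v \<in> Val UNIV" for e u v
    using that by (rule Val_add[OF p_family_is_ideal[OF assms]])
  show "of_nat p * u \<in> Val (I (Suc e))" if u: "u \<in> Val (I e)" for e u
  proof -
    obtain x where x: "x \<in> I e" "x \<noteq> 0" "u = \<nu> (to_fract x)"
      using u unfolding Val_def by blast
    then have "of_nat p * u = \<nu> (to_fract (x ^ p))"
      by (simp add: nu_power to_fract_power)
    moreover have "x ^ p \<in> I (Suc e)"
      using p_family_power[OF assms x(1), of 1] by simp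
    ultimately show ?thesis
      using x(2) unfolding Val_def by force
  qed
qed

lemma ex_colength_bounds:
  "\<exists>v\<ge>0. \<forall>J \<tau>. is_ideal J \<longrightarrow> valuation_ideal \<tau> \<subseteq> J \<longrightarrow>
    colength J + residue_degree * count_below (Val J) (\<tau> - v) \<le> residue_degree * count_below (Val UNIV) \<tau> \<and>
    residue_degree * count_below (Val UNIV) (\<tau> - v) \<le> colength J + residue_degree * count_below (Val J) \<tau>"
proof -
  obtain v where v: "0 \<le> v" "\<And>J \<tau>. is_ideal J \<Longrightarrow> residue_degree * value_count (\<tau> - v) J \<le> total_rank \<tau> J"
    using ex_shift_total_rank_ge[OF finite_value_set_below] by blast
  have "colength J + residue_degree * count_below (Val J) (\<tau> - v) \<le> residue_degree * count_below (Val UNIV) \<tau> \<and>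
    residue_degree * count_below (Val UNIV) (\<tau> - v) \<le> colength J + residue_degree * count_below (Val J) \<tau>"
    if J: "is_ideal J" "valuation_ideal \<tau> \<subseteq> J" for J \<tau>
    using colength_add_total_rank[OF finite_value_set_below J] v(2)[OF J(1), of \<tau>] v(2)[OF is_ideal_UNIV, of \<tau>]
      total_rank_le[OF finite_value_set_below, of \<tau> J] total_rank_le[OF finite_value_set_below, of \<tau> UNIV]
    unfolding value_count_eq by linarith
  then show ?thesis
    using v(1) by blast
qed

lemma ex_colength_gap_bound:
  assumes I: "p_family p I" and p: "1 < p" and c: "1 \<le> c" "\<And>e. valuation_ideal (c * real p ^ e) \<subseteq> I e"
  shows "\<exists>C. \<forall>e. \<bar>real (colength (I e)) / real (p ^ e) ^ d - real residue_degree * gap p c (\<lambda>e. Val (I e)) e\<bar>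
    \<le> C / real p ^ e"
proof -
  obtain v where v: "0 \<le> v" and bounds: "\<And>J \<tau>. is_ideal J \<Longrightarrow> valuation_ideal \<tau> \<subseteq> J \<Longrightarrow>
    colength J + residue_degree * count_below (Val J) (\<tau> - v) \<le> residue_degree * count_below (Val UNIV) \<tau> \<and>
    residue_degree * count_below (Val UNIV) (\<tau> - v) \<le> colength J + residue_degree * count_below (Val J) \<tau>"
    using ex_colength_bounds by blast
  define C where "C = slab_rate c * (v + 1)"
  have "\<bar>real (colength (I e)) / real (p ^ e) ^ d - real residue_degree * gap p c (\<lambda>e. Val (I e)) e\<bar>
      \<le> real residue_degree * C / real p ^ e" for e
  proof -
    let ?q = "real p ^ e" and ?deg = "real residue_degree"
    define n where "n A t = real (count_below A t) / ?q ^ d" for A t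
    define len where "len = real (colength (I e)) / ?q ^ d"
    have q: "1 \<le> ?q"
      using p by simp
    have "n (Val J) (c * ?q) \<le> n (Val J) (c * ?q - v) + C / ?q" for J
      unfolding n_def C_def by (intro count_below_ratio_le_slab Val_mono c(1) q v) simp
    then have slab: "?deg * n (Val J) (c * ?q) \<le> ?deg * n (Val J) (c * ?q - v) + ?deg * C / ?q" for J
      using mult_left_mono[of _ _ ?deg] by (fastforce simp: distrib_left)
    have ratio: "(real k + ?deg * real l) / ?q ^ d = real k / ?q ^ d + ?deg * (real l / ?q ^ d)" for k l
      by (simp add: add_divide_distrib)
    have "real (colength (I e)) + ?deg * count_below (Val (I e)) (c * ?q - v)
        \<le> 0 + ?deg * count_below (Val UNIV) (c * ?q)"
      "0 + ?deg * count_below (Val UNIV) (c * ?q - v)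
        \<le> real (colength (I e)) + ?deg * count_below (Val (I e)) (c * ?q)"
      using bounds[OF p_family_is_ideal[OF I] c(2)] by (simp_all flip: of_nat_mult of_nat_add)
    then have "len + ?deg * n (Val (I e)) (c * ?q - v) \<le> ?deg * n (Val UNIV) (c * ?q)"
      "?deg * n (Val UNIV) (c * ?q - v) \<le> len + ?deg * n (Val (I e)) (c * ?q)"
      using q ratio[of 0] unfolding n_def len_def ratio[symmetric] by (simp_all add: divide_right_mono)
    moreover have "gap p c (\<lambda>e. Val (I e)) e = n (Val UNIV) (c * ?q) - n (Val (I e)) (c * ?q)"
      by (simp add: gap_def density_def n_def)
    ultimately have "\<bar>len - ?deg * gap p c (\<lambda>e. Val (I e)) e\<bar> \<le> ?deg * C / ?q"
      using slab[of "I e"] slab[of UNIV] by (simp add: right_diff_distrib abs_le_iff)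
    then show ?thesis
      by (simp add: len_def)
  qed
  then show ?thesis
    by blast
qed

lemma volume_eq_limit:
  assumes I: "p_family p I" and p: "1 < p" and c: "1 \<le> c" "\<And>e. valuation_ideal (c * real p ^ e) \<subseteq> I e"
    and lim: "gap p c (\<lambda>e. Val (I e)) \<longlonglongrightarrow> l"
  shows "volume p d I = real residue_degree * l"
proof -
  let ?col = "\<lambda>e. real (colength (I e)) / real (p ^ e) ^ d"
  let ?gap = "\<lambda>e. real residue_degree * gap p c (\<lambda>e. Val (I e)) e"
  obtain C where bound: "\<And>e. \<bar>?col e - ?gap e\<bar> \<le> C / real p ^ e"
    using ex_colength_gap_bound[OF I p c] by blast
  have "(\<lambda>e. \<bar>?col e - ?gap e\<bar>) \<longlonglongrightarrow> 0"
    by (rule tendsto_sandwich[OF _ _ tendsto_const inverse_power_tendsto_0[OF p, of C]])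
      (intro always_eventually allI abs_ge_zero bound)+
  then have "(\<lambda>e. ?col e - ?gap e) \<longlonglongrightarrow> 0"
    by (rule tendsto_rabs_zero_cancel)
  then have "?col \<longlonglongrightarrow> real residue_degree * l"
    using tendsto_add[OF _ tendsto_mult_left[OF lim, of "real residue_degree"]] by fastforce
  then show ?thesis
    unfolding volume_def by (rule limI)
qed

lemma shallow_if_not_subset_frob_pow:
  assumes "0 < p" and not_subset: "\<not> (\<exists>e0. \<forall>e. I (e + e0) \<subseteq> frob_pow (p ^ e) m)"
  shows "\<exists>\<kappa>. \<forall>j. \<exists>e. \<exists>w\<in>Val (I (e + j)). wt w < \<kappa> * real p ^ e"
proof -
  obtain \<kappa> where \<kappa>: "\<And>q. 0 < q \<Longrightarrow> valuation_ideal (\<kappa> * real q) \<subseteq> frob_pow q m"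
    using ex_valuation_ideal_subset_frob_pow by blast
  have "\<exists>e. \<exists>w\<in>Val (I (e + j)). wt w < \<kappa> * real p ^ e" for j
  proof -
    obtain e x where x: "x \<in> I (e + j)" "x \<notin> frob_pow (p ^ e) m"
      using not_subset by blast
    then have "x \<notin> valuation_ideal (\<kappa> * real (p ^ e))"
      using \<kappa>[of "p ^ e"] \<open>0 < p\<close> by auto
    then have "x \<noteq> 0" "W (to_fract x) < \<kappa> * real p ^ e"
      by (simp_all add: valuation_ideal_def F_ge_def)
    then show ?thesis
      using nu_mem_Val[OF x(1)] unfolding W_def by blast
  qed
  then show ?thesis
    by blast
qed

lemma deep_if_subset_frob_pow:
  assumes "0 < p" and subset: "\<And>e. I (e + e0) \<subseteq> frob_pow (p ^ e) m"
  shows "\<exists>\<delta>>0. \<forall>\<^sub>F e in sequentially. \<forall>u\<in>Val (I e). \<delta> * real p ^ e \<le> wt u"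
proof -
  obtain \<delta> where \<delta>: "0 < \<delta>" "\<And>q. frob_pow q m \<subseteq> valuation_ideal (\<delta> * real q)"
    using ex_frob_pow_subset_valuation_ideal by blast
  have "\<delta> / real p ^ e0 * real p ^ e \<le> wt u" if e: "e0 \<le> e" and u: "u \<in> Val (I e)" for e u
  proof -
    obtain x where x: "x \<in> I e" "x \<noteq> 0" "u = \<nu> (to_fract x)"
      using u unfolding Val_def by blast
    have "x \<in> valuation_ideal (\<delta> * real (p ^ (e - e0)))"
      using subset[of "e - e0"] \<delta>(2)[of "p ^ (e - e0)"] x(1) e by auto
    then have "\<delta> * real p ^ (e - e0) \<le> wt u"
      using x by (simp add: valuation_ideal_def F_ge_def W_def)
    then show ?thesis
      using \<open>0 < p\<close> e by (simp add: power_diff)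
  qed
  then show ?thesis
    using \<delta>(1) \<open>0 < p\<close> by (intro exI[of _ "\<delta> / real p ^ e0"]) (auto simp: eventually_sequentially)
qed

theorem volume_pos_iff:
  assumes p: "1 < p" and I: "p_family p I" and rad: "m \<subseteq> radical (I 0)"
  shows "volume p d I > 0 \<longleftrightarrow> (\<exists>e0. \<forall>e. I (e + e0) \<subseteq> frob_pow (p ^ e) m)"
proof -
  have "0 < p"
    using p by simp
  obtain c where c: "1 \<le> c" "\<And>e. valuation_ideal (c * real p ^ e) \<subseteq> I e"
    using ex_valuation_ideal_subset_p_family[OF I rad \<open>0 < p\<close>] by blast
  let ?gap = "gap p c (\<lambda>e. Val (I e))"
  note T = p_system_Val[OF I]
  obtain l where l: "?gap \<longlonglongrightarrow> l"
    using gap_convergent[OF T p c(1)] unfolding convergent_def by blast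
  have "0 < volume p d I \<longleftrightarrow> 0 < l"
    using volume_eq_limit[OF I p c l] residue_degree_pos by (simp add: zero_less_mult_iff)
  also have "\<dots> \<longleftrightarrow> (\<exists>e0. \<forall>e. I (e + e0) \<subseteq> frob_pow (p ^ e) m)"
  proof
    assume "0 < l"
    then show "\<exists>e0. \<forall>e. I (e + e0) \<subseteq> frob_pow (p ^ e) m"
      using shallow_if_not_subset_frob_pow[OF \<open>0 < p\<close>] gap_limit_nonpos[OF T p c(1) l] by (meson not_le)
  next
    assume "\<exists>e0. \<forall>e. I (e + e0) \<subseteq> frob_pow (p ^ e) m"
    then show "0 < l"
      using deep_if_subset_frob_pow[OF \<open>0 < p\<close>] gap_limit_pos[OF T p c(1) l] by blast
  qed
  finally show ?thesis .
qed

end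

theorem mainTheorem5:
  fixes m :: "'a::idom set" and I :: "nat \<Rightarrow> 'a set" and p d :: nat and a :: "nat \<Rightarrow> real"
  assumes "prime p" and "CHAR('a) = p"
    and "local_ring_with_max m"
    and "krull_dim_eq TYPE('a) d"
    and "rat_lin_indep d a"
    and "ok_domain d a m"
    and "p_family p I"
    and "\<forall>e. m_primary m (I e)"
  shows "volume p d I > 0 \<longleftrightarrow> (\<exists>e0. \<forall>e. I (e + e0) \<subseteq> frob_pow (p ^ e) m)"
proof -
  obtain \<nu> where "ok_valuation d a m \<nu>"
    using \<open>ok_domain d a m\<close> unfolding ok_domain_def by blast
  then interpret ok_local_domain m d a \<nu>
    using assms by unfold_locales
  show ?thesis
  proof (rule volume_pos_iff)
    show "1 < p"
      using \<open>prime p\<close> by (rule prime_gt_1_nat)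
    show "m \<subseteq> radical (I 0)"
      using \<open>\<forall>e. m_primary m (I e)\<close> unfolding m_primary_def by blast
  qed fact
qed

end
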